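(* Let $f:\mathbb{R}^+\to\mathbb{R}$ be twice continuously differentiable with $f>0$, $f'>0$, $f''>0$, and assume there exist constants $c_1\geq 1/2$ and $c_2>0$ such that $c_1 f''(x)\leq f''(y)\leq c_2 f''(x)$ whenever $0<x\leq y\leq 2x$. Let $A_0\geq 2$ be such that $f'(A_0)\geq 1$. Then there exists a constant $C=C(f)$ such that for every function $\varphi:\mathbb{N}\to\mathbb{C}$ with $|\varphi(m)|\leq 1$ for all $m$, for all integers $A\geq A_0$ and for all real $z>0$, \[ \frac 1A\left|\sum_{A<n\leq 2A}\varphi\bigl(\lfloor f(n)\rfloor\bigr)-\sum_{f(A)<m\leq f(2A)}\varphi(m)\,(f^{-1})'(m)\right| \leq C\left(\frac{f''(A)}{f'(A)^2}z^2+f'(A)(\log A)^3 J(A,z)\right), \] where \[ J(A,z)=\int_0^1\sup_{f(A)<x\leq f(2A)}\frac 1z\left|\sum_{x<m\leq x+z}\varphi(m)\,e(m\theta)\right|\,d\theta . \]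
   Context: $e(x)=e^{2\pi i x}$; $\lfloor\cdot\rfloor$ is the floor function; $\mathbb{N}$ denotes the nonnegative integers; sums over $m$ or $n$ range over integers in the indicated intervals. $f^{-1}$ is the inverse function of the strictly increasing function $f$. *)

theory Defs
  imports "HOL-Analysis.Analysis"
begin

definition e :: "real \<Rightarrow> complex" where
  "e x = exp (2 * pi * \<i> * complex_of_real x)"

definition J :: "(real \<Rightarrow> real) \<Rightarrow> (nat \<Rightarrow> complex) \<Rightarrow> nat \<Rightarrow> real \<Rightarrow> real" where
  "J f \<phi> A z = integral {0..1} (\<lambda>\<theta>.
      SUP x\<in>{f (real A)<..f (real (2*A))}.
        (1 / z) * cmod (\<Sum>m\<in>{m::nat. x < real m \<and> real m \<le> x + z}. \<phi> m * e (real m * \<theta>)))"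

end

theory Submission
  imports Defs
begin

text \<open>
  Write \<open>g\<close> for the inverse of \<open>f\<close>. The number of \<open>n\<close> with \<open>\<lfloor>f n\<rfloor> = m\<close> is
  \<open>\<lceil>g (m + 1)\<rceil> - \<lceil>g m\<rceil>\<close>, to be compared with \<open>g' m\<close>. On a block \<open>x < m \<le> x + z\<close> the function \<open>g\<close>
  is replaced by its tangent at \<open>x\<close>; the ceiling can change only if the tangent comes close to an
  integer. The ceiling is approximated by the primitive of a Fejer kernel, which produces block sums
  of \<open>\<phi> m * e (h * g' x * m)\<close>, while the points close to an integer are counted by nonnegative
  Fejer kernels, which produces geometric sums with the same frequencies. Averaging over \<open>x\<close> makes the
  slope \<open>g' x\<close> move, so that every average over \<open>x\<close> becomes an integral over a period.

  Every \<open>\<bar>\<phi> m\<bar>\<close> is at most \<open>z * J\<close>, being a Fourier coefficient of a block sum. This absorbs the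
  error terms that do not contain \<open>\<phi>\<close> and, by the trivial estimate, settles \<open>z \<le> 8 f' log\<^sup>3 A\<close>. The
  condition \<open>c1 \<ge> 1/2\<close> enters through \<open>f' A = O(A f'' A log A)\<close>.
\<close>

section \<open>Exponential sums over short intervals\<close>

text \<open>\<open>J\<close> controls block sums only on average over the frequency, whereas the
  block at \<open>x\<close> meets the specific frequencies \<open>h * g' x\<close>. Over the whole
  range such a frequency sweeps an interval of length about \<open>h A f''/f'^2\<close>, possibly
  less than one period; rounding up to full periods costs a term of order
  \<open>f'^3/(f'' h)\<close>. Replacing \<open>f'/f''\<close> by \<open>O(A log A)\<close> spends
  the first logarithm but leaves one factor \<open>f'\<close> too many. It is recovered from the
  Fourier coefficients: a ceiling difference over a step \<open>p \<le> 1/f'\<close> has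
  \<open>h\<close>-th coefficient \<open>O(min (1/f') (1/h))\<close>, and \<open>1/f'\<close> is
  used exactly against the excess term. The sum over \<open>1/h\<close> gives the second logarithm,
  which suffices for the block sums of \<open>\<phi>\<close>; the third comes from the mean of a
  geometric sum in the kernel errors.

  Two kernel degrees occur. \<open>N\<close> is about \<open>z\<close> and governs the truncation of
  the ceiling. \<open>N1\<close> is about the inverse of the tangent error \<delta>, which is of
  order \<open>f'' z^2/f'^3\<close>, but is capped at \<open>N\<close>; thus \<open>1/N1\<close> is
  \<open>O(\<delta> + 1/N)\<close>.\<close>

lemma e_conv_cis: "e x = cis (2 * pi * x)"
  by (simp add: e_def cis_conv_exp mult_ac)

lemma e_add: "e (x + y) = e x * e y"
  by (simp add: e_conv_cis cis_mult distrib_left)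

lemma e_0 [simp]: "e 0 = 1"
  by (simp add: e_conv_cis)

lemma norm_e [simp]: "cmod (e x) = 1"
  by (simp add: e_conv_cis)

lemma e_of_int [simp]: "e (of_int n) = 1"
  by (simp add: e_conv_cis)

lemma e_add_of_int: "e (x + of_int n) = e x"
  by (simp add: e_add)

lemma continuous_on_e [continuous_intros]:
  "continuous_on S g \<Longrightarrow> continuous_on S (\<lambda>x. e (g x))"
  unfolding e_def by (intro continuous_intros)

lemma norm_e_diff_one: "cmod (e x - 1) = 2 * \<bar>sin (pi * x)\<bar>"
proof -
  have "e x - 1 = cis (pi * x) * (cis (pi * x) - cis (- (pi * x)))"
    by (simp add: e_conv_cis right_diff_distrib cis_mult flip: mult.assoc)
  also have "cis (pi * x) - cis (- (pi * x)) = 2 * \<i> * complex_of_real (sin (pi * x))"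
    by (simp add: complex_eq_iff)
  finally show ?thesis
    by (simp add: norm_mult)
qed

lemma norm_e_diff_one_le: "cmod (e x - 1) \<le> 2 * pi * \<bar>x\<bar>"
  using abs_sin_x_le_abs_x[of "pi * x"] by (simp add: norm_e_diff_one abs_mult)

lemma sin_pi_mult_ge:
  assumes "0 \<le> t" "t \<le> 1/2"
  shows "2 * t \<le> sin (pi * t)"
proof -
  have conc: "concave_on {0..pi/2} sin"
    by (rule f''_le0_imp_concave[where f'=cos and f''="\<lambda>x. - sin x"])
       (auto intro!: derivative_eq_intros sin_ge_zero)
  have "(1 - 2*t) * sin 0 + (2*t) * sin (pi/2) \<le> sin ((1 - 2*t) *\<^sub>R 0 + (2*t) *\<^sub>R (pi/2))"
    by (rule concave_onD[OF conc]) (use assms in auto)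
  then show ?thesis by (simp add: mult_ac)
qed

lemma abs_sin_pi_add_of_int: "\<bar>sin (pi * (t + of_int n))\<bar> = \<bar>sin (pi * t)\<bar>"
  using norm_e_diff_one[of "t + of_int n"] norm_e_diff_one[of t] by (simp add: e_add_of_int)

text \<open>Telescoping after multiplication by \<open>e t - 1\<close>. The product form stays valid
  where \<open>sin (pi * t)\<close> vanishes.\<close>

lemma norm_sum_e_atLeastLessThan_le:
  assumes "a \<le> b"
  shows "cmod (\<Sum>m=a..<b. e (real m * t)) * \<bar>sin (pi * t)\<bar> \<le> 1"
proof -
  have "(e t - 1) * (\<Sum>m=a..<b. e (real m * t)) = (\<Sum>m=a..<b. e (real (Suc m) * t) - e (real m * t))"
    by (simp add: sum_distrib_left e_add left_diff_distrib distrib_right flip: e_add)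
  also have "\<dots> = e (real b * t) - e (real a * t)"
    using assms by (rule sum_Suc_diff')
  finally have "cmod (e t - 1) * cmod (\<Sum>m=a..<b. e (real m * t)) = cmod (e (real b * t) - e (real a * t))"
    by (metis norm_mult)
  also have "\<dots> \<le> 2"
    using norm_triangle_ineq4[of "e (real b * t)" "e (real a * t)"] by simp
  finally show ?thesis
    by (simp add: norm_e_diff_one mult_ac)
qed

lemma integer_block_conv:
  assumes "0 \<le> x" "0 \<le> z"
  shows "{m::nat. x < real m \<and> real m \<le> x + z} = {nat \<lfloor>x\<rfloor> + 1..<nat \<lfloor>x + z\<rfloor> + 1}"
proof -
  have "x < real m \<longleftrightarrow> nat \<lfloor>x\<rfloor> < m" for m
    using assms by linarith
  moreover have "real m \<le> x + z \<longleftrightarrow> m \<le> nat \<lfloor>x + z\<rfloor>" for m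
    using assms by linarith
  ultimately show ?thesis by auto
qed

lemma finite_integer_block [simp]: "finite {m::nat. x < real m \<and> real m \<le> y}"
  by (rule finite_subset[of _ "{..nat \<lfloor>y\<rfloor>}"]) (auto simp: le_nat_floor)

lemma card_integer_block_le:
  assumes "0 \<le> x" "x \<le> y"
  shows "real (card {m::nat. x < real m \<and> real m \<le> y}) \<le> y - x + 1"
proof -
  have "\<lfloor>x\<rfloor> \<le> \<lfloor>y\<rfloor>" using assms by (intro floor_mono) auto
  then show ?thesis
    using integer_block_conv[of x "y - x"] assms by simp linarith
qed

text \<open>This is \<open>min (z + 1) (1 / \<bar>sin (\<pi> t)\<bar>)\<close>, written so that no division by zero occurs.\<close>

definition geom_bound :: "real \<Rightarrow> real \<Rightarrow> real" where
  "geom_bound z t = 1 / max (1 / (z + 1)) \<bar>sin (pi * t)\<bar>"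

lemma geom_bound_nonneg: "0 \<le> z \<Longrightarrow> 0 \<le> geom_bound z t"
  by (simp add: geom_bound_def)

lemma geom_bound_0: "0 \<le> z \<Longrightarrow> geom_bound z 0 = z + 1"
  by (simp add: geom_bound_def)

lemma geom_bound_minus: "geom_bound z (- t) = geom_bound z t"
  by (simp add: geom_bound_def)

lemma geom_bound_add_1: "geom_bound z (t + 1) = geom_bound z t"
  using abs_sin_pi_add_of_int[of t 1] by (simp add: geom_bound_def)

lemma continuous_on_geom_bound:
  assumes "0 \<le> z"
  shows "continuous_on S (geom_bound z)"
proof -
  have "max (1 / (z + 1)) \<bar>sin (pi * t)\<bar> \<noteq> 0" for t
    using assms by (smt (verit) divide_pos_pos)
  then show ?thesis
    unfolding geom_bound_def by (intro continuous_intros) auto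
qed

lemma norm_sum_e_block_le:
  assumes "0 \<le> x" "0 \<le> z"
  shows "cmod (\<Sum>m\<in>{m::nat. x < real m \<and> real m \<le> x + z}. e (real m * t)) \<le> geom_bound z t"
    (is "cmod ?S \<le> _")
proof -
  have "cmod ?S \<le> real (card {m::nat. x < real m \<and> real m \<le> x + z})"
    by (rule order.trans[OF sum_norm_le[where g="\<lambda>_. 1"]]) auto
  with card_integer_block_le[of x "x + z"] assms have 1: "cmod ?S \<le> z + 1" by simp
  have "nat \<lfloor>x\<rfloor> + 1 \<le> nat \<lfloor>x + z\<rfloor> + 1"
    using assms by (simp add: floor_mono nat_mono)
  from norm_sum_e_atLeastLessThan_le[OF this, of t]
  have 2: "cmod ?S * \<bar>sin (pi * t)\<bar> \<le> 1"
    by (simp only: integer_block_conv[OF assms])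
  have "cmod ?S * max (1 / (z + 1)) \<bar>sin (pi * t)\<bar> \<le> 1"
    using 1 2 assms by (auto simp: max_def field_simps)
  moreover have "max (1 / (z + 1)) \<bar>sin (pi * t)\<bar> > 0"
    using assms by (smt (verit) divide_pos_pos)
  ultimately show ?thesis
    by (simp add: geom_bound_def field_simps)
qed

text \<open>The mean of a geometric sum over a period is only logarithmic in its length, although
  its maximum is of size \<open>z\<close>.\<close>

lemma integral_geom_bound_le:
  assumes z: "0 \<le> z"
  shows "integral {0..1} (geom_bound z) \<le> 2 * ln (2 * z + 3)"
proof -
  define \<eta> where "\<eta> = 1 / (z + 1)"
  have \<eta>: "\<eta> > 0" using z by (simp add: \<eta>_def)
  \<comment> \<open>A maximum is at least half the sum, and \<open>\<bar>sin (pi * t)\<bar>\<close>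
    is at least twice the distance to the nearer of 0 and 1. Adding the contributions of both
    endpoints gives a single majorant with an explicit primitive.\<close>
  define H where "H = (\<lambda>t. 2 / (\<eta> + 2 * t) + 2 / (\<eta> + 2 * (1 - t)))"
  have "((\<lambda>t. ln (\<eta> + 2 * t) - ln (\<eta> + 2 * (1 - t))) has_vector_derivative H t) (at t within {0..1})"
    if "t \<in> {0..1}" for t
    unfolding has_real_derivative_iff_has_vector_derivative[symmetric] H_def
    using that \<eta> by (auto intro!: derivative_eq_intros)
  then have int: "(H has_integral (ln (\<eta> + 2 * 1) - ln (\<eta> + 2 * (1 - 1)) - (ln (\<eta> + 2 * 0) - ln (\<eta> + 2 * (1 - 0))))) {0..1}"
    by (intro fundamental_theorem_of_calculus) auto
  have "geom_bound z t \<le> H t" if t: "t \<in> {0..1}" for t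
  proof -
    have *: "1 / max \<eta> s \<le> 2 / (\<eta> + 2 * u)" if "2 * u \<le> s" "0 \<le> u" for s u
      using that \<eta> by (simp add: field_simps max_def)
    have nn: "0 \<le> 2 / (\<eta> + 2 * t)" "0 \<le> 2 / (\<eta> + 2 * (1 - t))" using t \<eta> by auto
    show ?thesis
    proof (cases "t \<le> 1/2")
      case True
      have "2 * t \<le> \<bar>sin (pi * t)\<bar>" using sin_pi_mult_ge[of t] True t by auto
      from *[OF this] nn t show ?thesis
        unfolding geom_bound_def H_def \<eta>_def[symmetric] atLeastAtMost_iff by linarith
    next
      case False
      have "2 * (1 - t) \<le> \<bar>sin (pi * (1 - t))\<bar>" using sin_pi_mult_ge[of "1 - t"] False t by auto
      also have "\<bar>sin (pi * (1 - t))\<bar> = \<bar>sin (pi * t)\<bar>"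
        using abs_sin_pi_add_of_int[of "-t" 1] by simp
      finally have "2 * (1 - t) \<le> \<bar>sin (pi * t)\<bar>" .
      from *[OF this] nn t show ?thesis
        unfolding geom_bound_def H_def \<eta>_def[symmetric] atLeastAtMost_iff by linarith
    qed
  qed
  then have "integral {0..1} (geom_bound z) \<le> integral {0..1} H"
    using integrable_continuous_real[OF continuous_on_geom_bound[OF z]] int
    by (intro integral_le) (auto simp: has_integral_integrable)
  also have "\<dots> = 2 * (ln (\<eta> + 2) - ln \<eta>)"
    using int by (simp add: integral_unique)
  also have "ln (\<eta> + 2) - ln \<eta> = ln ((\<eta> + 2) / \<eta>)"
    using \<eta> by (subst ln_div) auto
  also have "(\<eta> + 2) / \<eta> = 2 * z + 3"
    using z by (simp add: \<eta>_def field_simps)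
  finally show ?thesis by simp
qed

section \<open>Fejer kernels and the ceiling function\<close>

text \<open>Normalised so that \<open>fejer k 0 = 1\<close>; the usual Fejer kernel is \<open>k * fejer k\<close>.\<close>

definition fejer :: "nat \<Rightarrow> real \<Rightarrow> real" where
  "fejer k t = (cmod (\<Sum>j<k. e (real j * t)))\<^sup>2 / (real k)\<^sup>2"

text \<open>A primitive of \<open>N * fejer N\<close>, the kernel in its usual normalisation: the
  diagonal of the squared sum gives \<open>t\<close>, the other cosines integrate to sines. The
  deviation from \<open>t\<close> has period 1 and approximates the sawtooth
  \<open>\<lceil>t\<rceil> - t - 1/2\<close>.\<close>

definition fejer_primitive :: "nat \<Rightarrow> real \<Rightarrow> real" where
  "fejer_primitive N t = t + (\<Sum>k<N. \<Sum>l\<in>{..<N}-{k}.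
     sin (2 * pi * (real k - real l) * t) / (2 * pi * (real k - real l))) / real N"

lemma fejer_nonneg: "0 \<le> fejer k t"
  by (simp add: fejer_def)

lemma fejer_1: "fejer 1 t = 1"
  by (simp add: fejer_def)

lemma fejer_add_of_int: "fejer k (t + of_int n) = fejer k t"
proof -
  have "e (real j * (t + of_int n)) = e (real j * t)" for j
    using e_add_of_int[of "real j * t" "int j * n"] by (simp add: distrib_left)
  then show ?thesis by (simp add: fejer_def)
qed

lemma norm_sum_e_power2:
  "complex_of_real ((cmod (\<Sum>j<k. e (real j * t)))\<^sup>2) = (\<Sum>j<k. \<Sum>l<k. e ((real j - real l) * t))"
proof -
  have "e (real j * t) * cnj (e (real l * t)) = e ((real j - real l) * t)" for j l
    by (simp add: e_conv_cis cis_cnj cis_mult algebra_simps)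
  then show ?thesis
    by (simp only: complex_norm_square cnj_sum sum_product)
qed

lemma fejer_conv_cos: "fejer k t = (\<Sum>j<k. \<Sum>l<k. cos (2 * pi * (real j - real l) * t)) / (real k)\<^sup>2"
proof -
  have "(cmod (\<Sum>j<k. e (real j * t)))\<^sup>2 = Re (\<Sum>j<k. \<Sum>l<k. e ((real j - real l) * t))"
    by (subst norm_sum_e_power2[symmetric]) simp
  then show ?thesis
    by (simp add: fejer_def e_conv_cis mult_ac)
qed

text \<open>All phases \<open>2 * pi * j * u\<close> with \<open>j < k\<close> stay within
  \<open>pi / 3\<close>, so every term has real part at least 1/2. This is the origin of the factor
  6 in all later smallness conditions.\<close>

lemma fejer_ge:
  assumes "k > 0" "\<bar>t - of_int n\<bar> \<le> 1 / (6 * real k)"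
  shows "1 / 4 \<le> fejer k t"
proof -
  define u where "u = t - of_int n"
  have u: "\<bar>u\<bar> \<le> 1 / (6 * real k)" and t: "t = u + of_int n"
    using assms by (auto simp: u_def)
  have "1 / 2 \<le> cos (2 * pi * (real j * u))" if "j < k" for j
  proof -
    have "\<bar>2 * pi * (real j * u)\<bar> = 2 * pi * (real j * \<bar>u\<bar>)"
      by (simp add: abs_mult)
    also have "\<dots> \<le> 2 * pi * (real k * (1 / (6 * real k)))"
      using that u by (intro mult_left_mono mult_mono) auto
    also have "\<dots> = pi / 3" using assms by simp
    finally have "cos (pi / 3) \<le> cos \<bar>2 * pi * (real j * u)\<bar>"
      by (intro cos_monotone_0_pi_le) auto
    then show ?thesis by (simp add: cos_60)
  qed
  then have "(\<Sum>j<k. 1 / 2) \<le> (\<Sum>j<k. cos (2 * pi * (real j * u)))"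
    by (intro sum_mono) auto
  also have "\<dots> = Re (\<Sum>j<k. e (real j * u))"
    by (simp add: e_conv_cis)
  also have "\<dots> \<le> cmod (\<Sum>j<k. e (real j * u))"
    by (rule complex_Re_le_cmod)
  finally have "(real k / 2)\<^sup>2 \<le> (cmod (\<Sum>j<k. e (real j * u)))\<^sup>2"
    by (intro power_mono) auto
  then have "1 / 4 \<le> fejer k u"
    using assms by (simp add: fejer_def field_simps)
  then show ?thesis by (simp add: t fejer_add_of_int)
qed

lemma fejer_le:
  assumes "k > 0" "0 < t" "t \<le> 1/2"
  shows "fejer k t \<le> 1 / (4 * (real k)\<^sup>2 * t\<^sup>2)"
proof -
  have s: "2 * t \<le> sin (pi * t)" using assms by (intro sin_pi_mult_ge) auto
  have "cmod (\<Sum>j<k. e (real j * t)) * (2 * t) \<le> cmod (\<Sum>j<k. e (real j * t)) * \<bar>sin (pi * t)\<bar>"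
    using s assms by (intro mult_left_mono) auto
  also have "\<dots> \<le> 1"
    using norm_sum_e_atLeastLessThan_le[of 0 k t] by (simp add: atLeast0LessThan)
  finally have "(cmod (\<Sum>j<k. e (real j * t)) * (2 * t))\<^sup>2 \<le> 1\<^sup>2"
    using assms by (intro power_mono) auto
  then show ?thesis
    using assms by (simp add: fejer_def field_simps power_mult_distrib)
qed

lemma fejer_primitive_deriv:
  assumes "N > 0"
  shows "(fejer_primitive N has_real_derivative real N * fejer N t) (at t)"
proof -
  have "(\<Sum>l<N. cos (2 * pi * (real k - real l) * t)) =
        1 + (\<Sum>l\<in>{..<N}-{k}. cos (2 * pi * (real k - real l) * t))" if "k < N" for k
    using that by (subst sum.remove[of _ k]) auto
  then have eq: "real N * fejer N t = 1 +
      (\<Sum>k<N. \<Sum>l\<in>{..<N}-{k}. cos (2 * pi * (real k - real l) * t)) / real N"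
    using assms by (simp add: fejer_conv_cos sum.distrib field_simps power2_eq_square)
  have *: "((\<lambda>t. sin (c * t) / c) has_real_derivative cos (c * t)) (at t)"
    if "c \<noteq> 0" for c :: real
    using that by (auto intro!: derivative_eq_intros)
  show ?thesis
    unfolding fejer_primitive_def eq
    by (intro DERIV_add DERIV_ident DERIV_cdivide DERIV_sum *) auto
qed

lemma fejer_primitive_minus: "fejer_primitive N (- t) = - fejer_primitive N t"
  by (simp add: fejer_primitive_def sum_negf)

lemma fejer_primitive_add_of_int: "fejer_primitive N (t + of_int n) = fejer_primitive N t + of_int n"
proof -
  have "sin (2 * pi * (real k - real l) * (t + of_int n)) = sin (2 * pi * (real k - real l) * t)" for k l
  proof -
    have "sin (2 * pi * (real k - real l) * (t + of_int n)) =
          sin (2 * pi * (real k - real l) * t + 2 * pi * of_int ((int k - int l) * n))"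
      by (simp add: algebra_simps)
    also have "\<dots> = sin (2 * pi * (real k - real l) * t)"
      unfolding sin_add by (simp only: cos_int_2pin sin_int_2pin mult_1_right mult_zero_right add_0_right)
    finally show ?thesis .
  qed
  then show ?thesis by (simp add: fejer_primitive_def)
qed

lemma fejer_primitive_mono:
  assumes "N > 0" "s \<le> t"
  shows "fejer_primitive N s \<le> fejer_primitive N t"
proof (rule DERIV_nonneg_imp_nondecreasing[OF assms(2)])
  show "\<exists>y. (fejer_primitive N has_real_derivative y) (at x) \<and> 0 \<le> y" for x
    using fejer_primitive_deriv[OF assms(1), of x] fejer_nonneg[of N x] by (intro exI[of _ "real N * fejer N x"]) auto
qed

lemma fejer_primitive_half: "fejer_primitive N (1/2) = 1/2"
  using fejer_primitive_add_of_int[of N "-1/2" 1] fejer_primitive_minus[of N "1/2"] by simp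

lemma fejer_primitive_0: "fejer_primitive N 0 = 0"
  by (simp add: fejer_primitive_def)

text \<open>The quadratic decay of the kernel, integrated from \<open>t\<close> to 1/2: adding
  \<open>1 / (4 * N * x)\<close> to the primitive produces a decreasing function.\<close>

lemma fejer_primitive_half_diff:
  assumes N: "N > 0" and t: "0 < t" "t \<le> 1/2"
  shows "1/2 - fejer_primitive N t \<le> 1 / (4 * real N * t)"
proof -
  have "fejer_primitive N (1/2) + 1 / (4 * real N * (1/2)) \<le> fejer_primitive N t + 1 / (4 * real N * t)"
  proof (rule DERIV_nonpos_imp_nonincreasing[OF t(2)])
    fix x assume x: "t \<le> x" "x \<le> 1/2"
    have "((\<lambda>x. fejer_primitive N x + 1 / (4 * real N * x)) has_real_derivative
            (real N * fejer N x - 1 / (4 * real N * x\<^sup>2))) (at x)"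
      using N x t by (auto intro!: derivative_eq_intros fejer_primitive_deriv simp: field_simps power2_eq_square)
    moreover have "real N * fejer N x \<le> real N * (1 / (4 * (real N)\<^sup>2 * x\<^sup>2))"
      using fejer_le[of N x] N x t by (intro mult_left_mono) auto
    then have "real N * fejer N x - 1 / (4 * real N * x\<^sup>2) \<le> 0"
      using N by (simp add: power2_eq_square)
    ultimately show "\<exists>y. ((\<lambda>x. fejer_primitive N x + 1 / (4 * real N * x)) has_real_derivative y) (at x) \<and> y \<le> 0"
      by blast
  qed
  moreover have "0 \<le> 1 / (4 * real N * (1/2))" by simp
  ultimately show ?thesis unfolding fejer_primitive_half by linarith
qed

text \<open>This average dominates \<open>min 1 (1 / (N * dist t \<int>))\<close> up to a constant, while its Fourier
  coefficients are only \<open>O(log N / N)\<close>.\<close>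

definition fejer_mean :: "nat \<Rightarrow> real \<Rightarrow> real" where
  "fejer_mean N t = (\<Sum>k=1..N. fejer k t) / real N"

lemma fejer_mean_minus: "fejer_mean N (- t) = fejer_mean N t"
  by (simp add: fejer_mean_def fejer_conv_cos)

lemma fejer_mean_add_of_int: "fejer_mean N (t + of_int n) = fejer_mean N t"
  by (simp add: fejer_mean_def fejer_add_of_int)

text \<open>All kernels of degree up to about \<open>1 / (6 * t)\<close> are at least 1/4 at
  \<open>t\<close>, so their sum is at least about \<open>min N (1 / t)\<close>. The two
  alternatives are the two available bounds for \<open>1/2 - fejer_primitive N t\<close>: the
  trivial one and the decay estimate.\<close>

lemma fejer_mean_ge:
  assumes N: "N > 0" and t: "0 \<le> t" "t \<le> 1/2"
  shows "1 / 2 \<le> 12 * fejer_mean N t \<or> t > 0 \<and> 1 / (4 * real N * t) \<le> 12 * fejer_mean N t"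
proof (cases "6 * real N * t \<le> 1")
  case True
  have "1 / 4 \<le> fejer k t" if "k \<in> {1..N}" for k
  proof (rule fejer_ge[where n=0])
    have "6 * real k * t \<le> 6 * real N * t" using that t by (intro mult_right_mono) auto
    with True that t show "\<bar>t - of_int 0\<bar> \<le> 1 / (6 * real k)" by (simp add: field_simps)
  qed (use that in auto)
  then have "(\<Sum>k=1..N. 1 / 4) \<le> (\<Sum>k=1..N. fejer k t)" by (intro sum_mono)
  then have "1 / 4 \<le> fejer_mean N t" using N by (simp add: fejer_mean_def field_simps)
  then show ?thesis by simp
next
  case False
  have tpos: "t > 0" using False t by (cases "t = 0") auto
  have nn: "0 \<le> fejer k t" for k by (rule fejer_nonneg)
  have "1 / (48 * t) \<le> (\<Sum>k=1..N. fejer k t)"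
  proof (cases "6 * t \<le> 1")
    case True
    \<comment> \<open>The largest degree that \<open>fejer_ge\<close> covers at \<open>t\<close>.
      Since \<open>1 / (6 * t) \<ge> 1\<close>, rounding down loses at most a factor 2, whence
      \<open>K / 4 \<ge> 1 / (48 * t)\<close>.\<close>
    define K where "K = nat \<lfloor>1 / (6 * t)\<rfloor>"
    have "1 / (6 * t) \<ge> 1" using True tpos by simp
    then have "K \<ge> 1" "real K \<le> 1 / (6 * t)" "1 / (6 * t) < real K + 1"
      unfolding K_def by linarith+
    then have K: "K \<ge> 1" "real K \<le> 1 / (6 * t)" "1 / (6 * t) \<le> 2 * real K"
      by linarith+
    have "real K * (6 * t) < real N * (6 * t)"
    proof -
      have "real K * (6 * t) \<le> 1" using K(2) tpos by (subst (asm) pos_le_divide_eq) auto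
      moreover have "real N * (6 * t) = 6 * real N * t" by simp
      ultimately show ?thesis using \<open>\<not> 6 * real N * t \<le> 1\<close> by linarith
    qed
    then have "real K < real N"
      using tpos by (simp add: mult_less_cancel_right)
    then have KN: "K \<le> N" by simp
    have "1 / 4 \<le> fejer k t" if "k \<in> {1..K}" for k
    proof (rule fejer_ge[where n=0])
      have "6 * real k * t \<le> 6 * real K * t" using that t by (intro mult_right_mono) auto
      also have "\<dots> \<le> 1" using K(2) tpos by (simp add: field_simps)
      finally show "\<bar>t - of_int 0\<bar> \<le> 1 / (6 * real k)" using that t by (simp add: field_simps)
    qed (use that in auto)
    then have "(\<Sum>k=1..K. 1 / 4) \<le> (\<Sum>k=1..K. fejer k t)" by (intro sum_mono)
    also have "\<dots> \<le> (\<Sum>k=1..N. fejer k t)" using KN by (intro sum_mono2 nn) auto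
    finally have "real K / 4 \<le> (\<Sum>k=1..N. fejer k t)" by simp
    moreover have "1 / (48 * t) = (1 / (6 * t)) / 8" by simp
    ultimately show ?thesis using K(3) by linarith
  next
    case False
    \<comment> \<open>Here \<open>fejer_ge\<close> covers no degree at all, but the kernel of degree
      1 is constantly 1.\<close>
    have "1 / (48 * t) \<le> 1" using False by (simp add: field_simps)
    also have "1 = fejer 1 t" by (simp only: fejer_1)
    also have "\<dots> \<le> (\<Sum>k=1..N. fejer k t)" using N by (intro member_le_sum nn) auto
    finally show ?thesis .
  qed
  then have "12 / N * (1 / (48 * t)) \<le> 12 / N * (\<Sum>k=1..N. fejer k t)"
    by (intro mult_left_mono) auto
  then have "1 / (4 * real N * t) \<le> 12 * fejer_mean N t"
    using N tpos by (simp add: fejer_mean_def mult_ac)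
  with tpos show ?thesis by blast
qed

text \<open>Both sides depend only on \<open>t = \<lceil>y\<rceil> - y\<close>, and the symmetry
  between \<open>t\<close> and \<open>1 - t\<close> reduces to \<open>t \<le> 1/2\<close>. There the
  primitive lies between 0 and 1/2, so the error is at most 1/2 and both alternatives of
  \<open>fejer_mean_ge\<close> apply.\<close>

lemma ceiling_approx_fejer:
  assumes N: "N > 0"
  shows "\<bar>of_int \<lceil>y\<rceil> - 1/2 - fejer_primitive N y\<bar> \<le> 12 * fejer_mean N y"
proof -
  define n where "n = \<lceil>y\<rceil>"
  define t where "t = of_int n - y"
  have t: "0 \<le> t" "t < 1" unfolding t_def n_def by linarith+
  have y: "y = - t + of_int n" by (simp add: t_def)
  have eq: "of_int \<lceil>y\<rceil> - 1/2 - fejer_primitive N y = fejer_primitive N t - 1/2"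
    using fejer_primitive_add_of_int[of N "- t" n]
    unfolding n_def[symmetric] y[symmetric] fejer_primitive_minus by simp
  have eq': "fejer_mean N y = fejer_mean N t"
    unfolding y by (simp only: fejer_mean_add_of_int fejer_mean_minus)
  have *: "\<bar>fejer_primitive N s - 1/2\<bar> \<le> 12 * fejer_mean N s" if s: "0 \<le> s" "s \<le> 1/2" for s
  proof -
    have "0 \<le> fejer_primitive N s" "fejer_primitive N s \<le> 1/2"
      using fejer_primitive_mono[OF N s(1)] fejer_primitive_mono[OF N s(2)]
      by (simp_all add: fejer_primitive_0 fejer_primitive_half)
    with fejer_primitive_half_diff[OF N _ s(2)] fejer_mean_ge[OF N s] show ?thesis
      by fastforce
  qed
  show ?thesis
  proof (cases "t \<le> 1/2")
    case True
    then show ?thesis unfolding eq eq' using * t by auto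
  next
    case False
    have "fejer_primitive N t = 1 - fejer_primitive N (1 - t)"
      using fejer_primitive_add_of_int[of N "-(1 - t)" 1] by (simp add: fejer_primitive_minus[of N "1 - t", simplified])
    moreover have "fejer_mean N t = fejer_mean N (1 - t)"
      using fejer_mean_add_of_int[of N "- t" 1] by (simp add: fejer_mean_minus)
    ultimately show ?thesis unfolding eq eq' using *[of "1 - t"] False t by auto
  qed
qed

section \<open>A single block\<close>

text \<open>In each row a given lag \<open>\<bar>k - l\<bar> = h\<close> occurs at most
  twice.\<close>

lemma sum_offdiagonal_le:
  fixes b :: "nat \<Rightarrow> real"
  assumes "\<And>h. 0 \<le> b h"
  shows "(\<Sum>k<N. \<Sum>l\<in>{..<N}-{k}. b (nat \<bar>int k - int l\<bar>)) \<le> 2 * real N * (\<Sum>h=1..<N. b h)"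
proof -
  have "(\<Sum>l\<in>{..<N}-{k}. b (nat \<bar>int k - int l\<bar>)) \<le> 2 * (\<Sum>h=1..<N. b h)" if k: "k < N" for k
  proof -
    have split: "{..<N} - {k} = {..<k} \<union> {k<..<N}" using k by auto
    have 1: "(\<Sum>l\<in>{..<k}. b (nat \<bar>int k - int l\<bar>)) = (\<Sum>h\<in>(\<lambda>l. k - l) ` {..<k}. b h)"
      by (subst sum.reindex) (auto simp: inj_on_def intro!: sum.cong arg_cong[where f=b])
    have 2: "(\<Sum>l\<in>{k<..<N}. b (nat \<bar>int k - int l\<bar>)) = (\<Sum>h\<in>(\<lambda>l. l - k) ` {k<..<N}. b h)"
      by (subst sum.reindex) (auto simp: inj_on_def intro!: sum.cong arg_cong[where f=b])
    have 3: "(\<Sum>h\<in>(\<lambda>l. k - l) ` {..<k}. b h) \<le> (\<Sum>h=1..<N. b h)"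
      using k assms by (intro sum_mono2) auto
    have 4: "(\<Sum>h\<in>(\<lambda>l. l - k) ` {k<..<N}. b h) \<le> (\<Sum>h=1..<N. b h)"
      using k assms by (intro sum_mono2) auto
    show ?thesis
      unfolding split by (subst sum.union_disjoint) (use 1 2 3 4 in auto)
  qed
  then have "(\<Sum>k<N. \<Sum>l\<in>{..<N}-{k}. b (nat \<bar>int k - int l\<bar>)) \<le> (\<Sum>k<N. 2 * (\<Sum>h=1..<N. b h))"
    by (intro sum_mono) auto
  then show ?thesis by (simp add: mult_ac)
qed

text \<open>Majorant for the sum of \<open>fejer k\<close> along a progression of slope
  \<open>p\<close>: the diagonal contributes \<open>z + 1\<close>, each lag \<open>h\<close> a
  geometric sum with frequency \<open>h * p\<close>.\<close>

definition fejer_bound :: "real \<Rightarrow> nat \<Rightarrow> real \<Rightarrow> real" where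
  "fejer_bound z k p = (z + 1 + 2 * (\<Sum>h=1..<k. geom_bound z (real h * p))) / real k"

lemma geom_bound_diff:
  "geom_bound z ((real j - real l) * p) = geom_bound z (real (nat \<bar>int j - int l\<bar>) * p)"
proof (cases "l \<le> j")
  case True
  then have "real (nat \<bar>int j - int l\<bar>) = real j - real l" by simp
  then show ?thesis by simp
next
  case False
  then have "real (nat \<bar>int j - int l\<bar>) = - (real j - real l)" by simp
  then show ?thesis by (simp only: mult_minus_left geom_bound_minus)
qed

text \<open>After expansion of the square the offset \<open>c\<close> survives only in phases of
  modulus 1. Uniformity in \<open>c\<close> matters because nothing is known about the intercept of
  a tangent modulo 1.\<close>

lemma sum_fejer_block_le:
  assumes x: "0 \<le> x" and z: "0 \<le> z" and k: "k > 0"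
  shows "(\<Sum>m\<in>{m::nat. x < real m \<and> real m \<le> x + z}. fejer k (c + p * real m)) \<le> fejer_bound z k p"
    (is "sum _ ?S \<le> _")
proof -
  have "complex_of_real ((real k)\<^sup>2 * (\<Sum>m\<in>?S. fejer k (c + p * real m)))
     = (\<Sum>m\<in>?S. complex_of_real ((cmod (\<Sum>j<k. e (real j * (c + p * real m))))\<^sup>2))"
    using k by (simp add: fejer_def sum_distrib_left)
  also have "\<dots> = (\<Sum>m\<in>?S. \<Sum>j<k. \<Sum>l<k. e ((real j - real l) * (c + p * real m)))"
    by (simp only: norm_sum_e_power2)
  also have "\<dots> = (\<Sum>j<k. \<Sum>m\<in>?S. \<Sum>l<k. e ((real j - real l) * (c + p * real m)))"
    by (rule sum.swap)
  also have "\<dots> = (\<Sum>j<k. \<Sum>l<k. \<Sum>m\<in>?S. e ((real j - real l) * (c + p * real m)))"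
    by (intro sum.cong refl sum.swap)
  also have "\<dots> = (\<Sum>j<k. \<Sum>l<k. e ((real j - real l) * c) * (\<Sum>m\<in>?S. e (real m * ((real j - real l) * p))))"
    by (simp add: sum_distrib_left algebra_simps flip: e_add)
  finally have eq: "complex_of_real ((real k)\<^sup>2 * (\<Sum>m\<in>?S. fejer k (c + p * real m))) = \<dots>" .
  have "(real k)\<^sup>2 * (\<Sum>m\<in>?S. fejer k (c + p * real m)) =
        cmod (complex_of_real ((real k)\<^sup>2 * (\<Sum>m\<in>?S. fejer k (c + p * real m))))"
    unfolding norm_of_real by (rule abs_of_nonneg[symmetric]) (simp add: sum_nonneg fejer_nonneg)
  also have "\<dots> \<le> (\<Sum>j<k. \<Sum>l<k. geom_bound z ((real j - real l) * p))"
    unfolding eq by (intro sum_norm_le) (simp add: norm_mult norm_sum_e_block_le[OF x z])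
  also have "\<dots> = (\<Sum>j<k. (z + 1) + (\<Sum>l\<in>{..<k}-{j}. geom_bound z (real (nat \<bar>int j - int l\<bar>) * p)))"
  proof (intro sum.cong refl)
    fix j assume "j \<in> {..<k}"
    then show "(\<Sum>l<k. geom_bound z ((real j - real l) * p)) =
        (z + 1) + (\<Sum>l\<in>{..<k}-{j}. geom_bound z (real (nat \<bar>int j - int l\<bar>) * p))"
      by (subst sum.remove[of _ j]) (simp_all add: geom_bound_0[OF z] geom_bound_diff)
  qed
  also have "\<dots> = real k * (z + 1) + (\<Sum>j<k. \<Sum>l\<in>{..<k}-{j}. geom_bound z (real (nat \<bar>int j - int l\<bar>) * p))"
    by (simp add: sum.distrib)
  also have "\<dots> \<le> real k * (z + 1) + 2 * real k * (\<Sum>h=1..<k. geom_bound z (real h * p))"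
    using sum_offdiagonal_le[of "\<lambda>h. geom_bound z (real h * p)" k] geom_bound_nonneg[OF z] by simp
  also have "\<dots> = (real k)\<^sup>2 * fejer_bound z k p"
    using k by (simp add: fejer_bound_def power2_eq_square field_simps)
  finally show ?thesis
    using k by simp
qed

lemma sin_conv_e: "complex_of_real (sin (2 * pi * u)) = (e u - e (- u)) / (2 * \<i>)"
  by (simp add: e_conv_cis complex_eq_iff)

text \<open>The divisor comes from a sine of frequency \<open>d\<close> divided by
  \<open>2 * pi * d\<close> and written through \<open>e\<close>. Keeping both bounds is essential:
  \<open>p\<close> for low frequencies, \<open>1 / \<bar>d\<bar>\<close> for high ones.\<close>

lemma norm_e_diff_one_div_le:
  assumes "0 \<le> p" "d \<noteq> 0"
  shows "cmod (e (d * p) - 1) / (4 * pi * \<bar>d\<bar>) \<le> min p (1 / \<bar>d\<bar>)"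
proof -
  have "cmod (e (d * p) - 1) \<le> 2 * pi * \<bar>d * p\<bar>" by (rule norm_e_diff_one_le)
  also have "\<dots> = p * (2 * pi * \<bar>d\<bar>)" using assms by (simp add: abs_mult)
  also have "\<dots> \<le> p * (4 * pi * \<bar>d\<bar>)" using assms by (intro mult_left_mono mult_right_mono) auto
  finally have 1: "cmod (e (d * p) - 1) / (4 * pi * \<bar>d\<bar>) \<le> p"
    using assms by (subst pos_divide_le_eq) auto
  have "cmod (e (d * p) - 1) \<le> 2" by (simp add: norm_e_diff_one)
  also have "\<dots> \<le> 4 * pi" using pi_gt3 by simp
  finally have "cmod (e (d * p) - 1) / (4 * pi * \<bar>d\<bar>) \<le> 4 * pi / (4 * pi * \<bar>d\<bar>)"
    using assms by (intro divide_right_mono) auto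
  then show ?thesis using 1 by simp
qed

text \<open>Subtracting \<open>p\<close> removes the linear part of the primitive. A step of length
  \<open>p\<close> multiplies each remaining exponential of frequency \<open>d\<close> by
  \<open>e (d * p) - 1\<close>, and its sum against \<open>\<phi>\<close> is a Fourier sum at
  \<open>d * p\<close> times a phase. The minimum is the bound for the coefficient.\<close>

lemma sum_fejer_primitive_diff_le:
  fixes \<phi> :: "nat \<Rightarrow> complex" and S :: "nat set"
  assumes N: "N > 0" and p: "0 \<le> p"
  defines "T \<equiv> \<lambda>\<theta>. cmod (\<Sum>m\<in>S. \<phi> m * e (real m * \<theta>))"
  shows "cmod (\<Sum>m\<in>S. \<phi> m * complex_of_real
            (fejer_primitive N (c + p * real m + p) - fejer_primitive N (c + p * real m) - p))
       \<le> 2 * (\<Sum>h=1..<N. min p (1 / real h) * (T (real h * p) + T (- (real h * p))))"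
proof -
  define y where "y = (\<lambda>m::nat. c + p * real m)"
  define s where "s = (\<lambda>d m. (sin (2 * pi * (d * (y m + p))) - sin (2 * pi * (d * y m))) / (2 * pi * d))"
  define b where "b = (\<lambda>h. min p (1 / real h) * (T (real h * p) + T (- (real h * p))))"
  have T0: "0 \<le> T \<theta>" for \<theta> by (simp add: T_def)
  have b0: "0 \<le> b h" for h using T0 p by (simp add: b_def)
  have offdiag: "cmod (\<Sum>m\<in>S. \<phi> m * complex_of_real (s (real k - real l) m)) \<le> b (nat \<bar>int k - int l\<bar>)"
    if kl: "k \<noteq> l" for k l
  proof -
    define d where "d = real k - real l"
    have d: "d \<noteq> 0" using kl by (simp add: d_def)
    have decomp: "(\<Sum>m\<in>S. \<phi> m * complex_of_real (s d m)) =
       ((e (d * p) - 1) * (e (d * c) * (\<Sum>m\<in>S. \<phi> m * e (real m * (d * p))))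
        - (e (- d * p) - 1) * (e (- d * c) * (\<Sum>m\<in>S. \<phi> m * e (real m * (- d * p))))) / (2 * \<i> * (2 * pi * d))"
    proof -
      have y1: "e (d * y m) = e (d * c) * e (real m * (d * p))"
           "e (- (d * y m)) = e (- d * c) * e (real m * (- d * p))"
           "e (d * (y m + p)) = e (d * c) * e (real m * (d * p)) * e (d * p)"
           "e (- (d * (y m + p))) = e (- d * c) * e (real m * (- d * p)) * e (- d * p)" for m
        by (simp_all add: y_def algebra_simps flip: e_add)
      have "\<phi> m * complex_of_real (s d m) =
         ((e (d * p) - 1) * (e (d * c) * (\<phi> m * e (real m * (d * p))))
        - (e (- d * p) - 1) * (e (- d * c) * (\<phi> m * e (real m * (- d * p))))) / (2 * \<i> * (2 * pi * d))" for m
        unfolding s_def of_real_divide of_real_diff sin_conv_e y1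
        using d by (simp add: field_simps)
      then show ?thesis
        by (simp add: sum_distrib_left sum_subtractf flip: sum_divide_distrib)
    qed
    have tri: "cmod ((u1 * (e v1 * w1) - u2 * (e v2 * w2)) / (2 * \<i> * (2 * pi * d)))
        \<le> (cmod u1 * cmod w1 + cmod u2 * cmod w2) / (4 * pi * \<bar>d\<bar>)" for u1 u2 w1 w2 v1 v2
      using norm_triangle_ineq4[of "u1 * (e v1 * w1)" "u2 * (e v2 * w2)"]
      by (simp add: norm_divide norm_mult divide_right_mono mult.assoc)
    have "cmod (\<Sum>m\<in>S. \<phi> m * complex_of_real (s d m)) \<le>
       (cmod (e (d * p) - 1) * T (d * p) + cmod (e (- d * p) - 1) * T (- d * p)) / (4 * pi * \<bar>d\<bar>)"
      unfolding T_def decomp by (rule tri)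
    also have "cmod (e (- d * p) - 1) = cmod (e (d * p) - 1)"
      by (simp add: norm_e_diff_one)
    also have "(cmod (e (d * p) - 1) * T (d * p) + cmod (e (d * p) - 1) * T (- d * p)) / (4 * pi * \<bar>d\<bar>)
       = cmod (e (d * p) - 1) / (4 * pi * \<bar>d\<bar>) * (T (d * p) + T (- d * p))"
      by (simp add: algebra_simps add_divide_distrib)
    also have "\<dots> \<le> min p (1 / \<bar>d\<bar>) * (T (d * p) + T (- d * p))"
      using norm_e_diff_one_div_le[OF p d] T0 by (intro mult_right_mono) auto
    also have "\<dots> = b (nat \<bar>int k - int l\<bar>)"
    proof (cases "l \<le> k")
      case True
      then have "real (nat \<bar>int k - int l\<bar>) = d" "\<bar>d\<bar> = d" by (simp_all add: d_def)
      then show ?thesis by (simp add: b_def)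
    next
      case False
      then have "real (nat \<bar>int k - int l\<bar>) = - d" "\<bar>d\<bar> = - d" by (simp_all add: d_def)
      then show ?thesis by (simp add: b_def)
    qed
    finally show ?thesis by (simp add: d_def)
  qed
  have "complex_of_real (fejer_primitive N (y m + p) - fejer_primitive N (y m) - p) =
        (\<Sum>k<N. \<Sum>l\<in>{..<N}-{k}. complex_of_real (s (real k - real l) m)) / N" for m
  proof -
    have "fejer_primitive N (y m + p) - fejer_primitive N (y m) - p =
        (\<Sum>k<N. \<Sum>l\<in>{..<N}-{k}. s (real k - real l) m) / N"
      by (simp add: fejer_primitive_def s_def diff_divide_distrib sum_subtractf mult.assoc)
    then show ?thesis by simp
  qed
  then have "(\<Sum>m\<in>S. \<phi> m * complex_of_real (fejer_primitive N (y m + p) - fejer_primitive N (y m) - p)) =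
     (\<Sum>m\<in>S. \<Sum>k<N. \<Sum>l\<in>{..<N}-{k}. \<phi> m * complex_of_real (s (real k - real l) m)) / N"
    by (simp add: sum_distrib_left sum_divide_distrib)
  also have "(\<Sum>m\<in>S. \<Sum>k<N. \<Sum>l\<in>{..<N}-{k}. \<phi> m * complex_of_real (s (real k - real l) m)) =
     (\<Sum>k<N. \<Sum>m\<in>S. \<Sum>l\<in>{..<N}-{k}. \<phi> m * complex_of_real (s (real k - real l) m))"
    by (rule sum.swap)
  also have "\<dots> = (\<Sum>k<N. \<Sum>l\<in>{..<N}-{k}. \<Sum>m\<in>S. \<phi> m * complex_of_real (s (real k - real l) m))"
    by (intro sum.cong refl sum.swap)
  finally have "cmod (\<Sum>m\<in>S. \<phi> m * complex_of_real (fejer_primitive N (y m + p) - fejer_primitive N (y m) - p))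
      = cmod (\<Sum>k<N. \<Sum>l\<in>{..<N}-{k}. \<Sum>m\<in>S. \<phi> m * complex_of_real (s (real k - real l) m)) / N"
    by (simp add: norm_divide)
  also have "\<dots> \<le> (\<Sum>k<N. \<Sum>l\<in>{..<N}-{k}. b (nat \<bar>int k - int l\<bar>)) / N"
    by (intro divide_right_mono sum_norm_le offdiag) auto
  also have "\<dots> \<le> (2 * real N * (\<Sum>h=1..<N. b h)) / N"
    by (intro divide_right_mono sum_offdiagonal_le b0) auto
  also have "\<dots> = 2 * (\<Sum>h=1..<N. b h)" using N by simp
  finally show ?thesis by (simp add: y_def b_def)
qed

text \<open>If the ceilings differ, the integer \<open>\<lceil>u\<rceil>\<close> lies in
  \<open>[u, y)\<close>, hence within \<delta> of \<open>y\<close>, where the kernel is at least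
  1/4. The hypothesis forces \<open>\<delta> \<le> 1/6\<close>, so the ceilings cannot differ by
  more than 1.\<close>

lemma ceiling_perturbation_fejer:
  assumes N1: "N1 > 0" and \<delta>: "6 * \<delta> * real N1 \<le> 1" and u: "y - \<delta> \<le> u" "u \<le> y"
  shows "\<bar>of_int \<lceil>u\<rceil> - of_int \<lceil>y\<rceil>\<bar> \<le> 4 * fejer N1 y"
proof (cases "\<lceil>u\<rceil> = \<lceil>y\<rceil>")
  case True
  then show ?thesis by (simp add: fejer_nonneg)
next
  case False
  have \<delta>0: "0 \<le> \<delta>" using u by simp
  have "6 * \<delta> * 1 \<le> 6 * \<delta> * real N1" using N1 \<delta>0 by (intro mult_left_mono) auto
  then have "\<delta> \<le> 1/6" using \<delta> by simp
  moreover have "\<lceil>u\<rceil> \<le> \<lceil>y\<rceil>" using u by (intro ceiling_mono)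
  ultimately have eq: "\<lceil>y\<rceil> = \<lceil>u\<rceil> + 1" and near: "\<bar>y - of_int \<lceil>u\<rceil>\<bar> \<le> \<delta>"
    using False u by linarith+
  have "\<delta> \<le> 1 / (6 * real N1)" using \<delta> N1 by (simp add: field_simps)
  with near have "1 / 4 \<le> fejer N1 y" by (intro fejer_ge[OF N1, of _ "\<lceil>u\<rceil>"]) auto
  then show ?thesis by (simp add: eq)
qed

text \<open>The line approximates \<open>g\<close> from above up to \<open>x + z + 1\<close>,
  because the last integer of the block also involves \<open>g (m + 1)\<close>. The bound
  \<open>M\<close> for \<open>\<phi>\<close> multiplies only the kernel errors; in the first sum
  \<open>\<phi>\<close> keeps its oscillation.\<close>

lemma block_estimate:
  fixes \<phi> :: "nat \<Rightarrow> complex" and g :: "real \<Rightarrow> real"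
  assumes x: "0 \<le> x" and z: "0 \<le> z" and N: "N > 0" and N1: "N1 > 0" and p: "0 \<le> p"
    and \<delta>: "6 * \<delta> * real N1 \<le> 1"
    and g: "\<And>m::nat. x < real m \<Longrightarrow> real m \<le> x + z + 1 \<Longrightarrow>
              c + p * real m - \<delta> \<le> g (real m) \<and> g (real m) \<le> c + p * real m"
    and \<phi>: "\<And>m. x < real m \<Longrightarrow> real m \<le> x + z \<Longrightarrow> cmod (\<phi> m) \<le> M"
  defines "S \<equiv> {m::nat. x < real m \<and> real m \<le> x + z}"
  defines "T \<equiv> \<lambda>\<theta>. cmod (\<Sum>m\<in>S. \<phi> m * e (real m * \<theta>))"
  assumes M: "0 \<le> M"
  shows "cmod (\<Sum>m\<in>S. \<phi> m * complex_of_real (of_int \<lceil>g (real m + 1)\<rceil> - of_int \<lceil>g (real m)\<rceil> - p))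
       \<le> 2 * (\<Sum>h=1..<N. min p (1 / real h) * (T (real h * p) + T (- (real h * p))))
         + M * (8 * fejer_bound z N1 p + 24 * ((\<Sum>k=1..N. fejer_bound z k p) / real N))"
proof -
  define U where "U = (\<lambda>y. 4 * fejer N1 y + 12 * fejer_mean N y)"
  define \<Phi> where "\<Phi> = fejer_primitive N"
  define W where "W = 4 * fejer_bound z N1 p + 12 * ((\<Sum>k=1..N. fejer_bound z k p) / real N)"
  have near: "\<bar>of_int \<lceil>g (real m)\<rceil> - 1/2 - \<Phi> (c + p * real m)\<bar> \<le> U (c + p * real m)"
    if "x < real m" "real m \<le> x + z + 1" for m
  proof -
    have "\<bar>real_of_int \<lceil>g (real m)\<rceil> - of_int \<lceil>c + p * real m\<rceil>\<bar> \<le> 4 * fejer N1 (c + p * real m)"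
      using g[OF that] by (intro ceiling_perturbation_fejer[OF N1 \<delta>]) auto
    with ceiling_approx_fejer[OF N, of "c + p * real m"] show ?thesis
      unfolding U_def \<Phi>_def by linarith
  qed
  have sumU: "(\<Sum>m\<in>S. U (c' + p * real m)) \<le> W" for c'
  proof -
    have "(\<Sum>m\<in>S. fejer_mean N (c' + p * real m)) = (\<Sum>k=1..N. \<Sum>m\<in>S. fejer k (c' + p * real m)) / real N"
      unfolding fejer_mean_def sum_divide_distrib[symmetric] by (subst sum.swap) simp
    also have "\<dots> \<le> (\<Sum>k=1..N. fejer_bound z k p) / real N"
      unfolding S_def by (intro divide_right_mono sum_mono sum_fejer_block_le x z) auto
    finally have 1: "(\<Sum>m\<in>S. fejer_mean N (c' + p * real m)) \<le> (\<Sum>k=1..N. fejer_bound z k p) / real N" .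
    have 2: "(\<Sum>m\<in>S. fejer N1 (c' + p * real m)) \<le> fejer_bound z N1 p"
      unfolding S_def by (intro sum_fejer_block_le x z N1)
    have "(\<Sum>m\<in>S. U (c' + p * real m)) =
        4 * (\<Sum>m\<in>S. fejer N1 (c' + p * real m)) + 12 * (\<Sum>m\<in>S. fejer_mean N (c' + p * real m))"
      by (simp add: U_def sum.distrib sum_distrib_left)
    then show ?thesis using 1 2 by (simp add: W_def)
  qed
  define a where "a = (\<lambda>m::nat. \<Phi> (c + p * real m + p) - \<Phi> (c + p * real m) - p)"
  define r where "r = (\<lambda>m::nat. (of_int \<lceil>g (real m + 1)\<rceil> - of_int \<lceil>g (real m)\<rceil> - p) - a m)"
  have r: "cmod (\<phi> m * complex_of_real (r m)) \<le> M * (U (c + p + p * real m) + U (c + p * real m))" if "m \<in> S" for m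
  proof -
    \<comment> \<open>The point belonging to \<open>m + 1\<close> lies on the same progression with
      offset \<open>c + p\<close>. As the kernel bound ignores offsets, both ceilings cost the same,
      which doubles 4 and 12 to 8 and 24.\<close>
    have "\<bar>r m\<bar> \<le> U (c + p + p * real m) + U (c + p * real m)"
      using near[of m] near[of "Suc m"] that unfolding r_def a_def S_def
      by (simp add: algebra_simps abs_le_iff)
    then show ?thesis
      using \<phi>[of m] that M by (auto simp: norm_mult S_def intro!: mult_mono)
  qed
  have "(\<Sum>m\<in>S. \<phi> m * complex_of_real (of_int \<lceil>g (real m + 1)\<rceil> - of_int \<lceil>g (real m)\<rceil> - p))
     = (\<Sum>m\<in>S. \<phi> m * complex_of_real (a m)) + (\<Sum>m\<in>S. \<phi> m * complex_of_real (r m))"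
    by (simp add: r_def sum.distrib[symmetric] algebra_simps)
  also have "cmod \<dots> \<le> cmod (\<Sum>m\<in>S. \<phi> m * complex_of_real (a m)) + cmod (\<Sum>m\<in>S. \<phi> m * complex_of_real (r m))"
    by (rule norm_triangle_ineq)
  also have "cmod (\<Sum>m\<in>S. \<phi> m * complex_of_real (r m)) \<le> (\<Sum>m\<in>S. M * (U (c + p + p * real m) + U (c + p * real m)))"
    by (intro sum_norm_le r)
  also have "\<dots> = M * ((\<Sum>m\<in>S. U (c + p + p * real m)) + (\<Sum>m\<in>S. U (c + p * real m)))"
    by (simp only: sum_distrib_left[symmetric] sum.distrib)
  also have "\<dots> \<le> M * (W + W)"
    by (intro mult_left_mono add_mono sumU M)
  also have "M * (W + W) = M * (8 * fejer_bound z N1 p + 24 * ((\<Sum>k=1..N. fejer_bound z k p) / real N))"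
    by (simp add: W_def)
  also have "cmod (\<Sum>m\<in>S. \<phi> m * complex_of_real (a m))
      \<le> 2 * (\<Sum>h=1..<N. min p (1 / real h) * (T (real h * p) + T (- (real h * p))))"
    unfolding a_def \<Phi>_def T_def by (rule sum_fejer_primitive_diff_le[OF N p])
  finally show ?thesis by simp
qed

section \<open>Averages over slopes and block suprema\<close>

lemma continuous_on_Max_image:
  fixes v :: "'i \<Rightarrow> 'a::topological_space \<Rightarrow> real"
  assumes "finite F" "F \<noteq> {}" "\<And>i. i \<in> F \<Longrightarrow> continuous_on S (v i)"
  shows "continuous_on S (\<lambda>t. Max ((\<lambda>i. v i t) ` F))"
  using assms
proof (induction F rule: finite_ne_induct)
  case (insert i F)
  have "continuous_on S (\<lambda>t. max (v i t) (Max ((\<lambda>i. v i t) ` F)))"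
    using insert by (intro continuous_on_max) auto
  then show ?case using insert by simp
qed simp

text \<open>\<Gamma> grows by the same amount over every period; rounding \<open>a\<close> down and
  \<open>b\<close> up to integers adds at most two periods.\<close>

lemma periodic_antiderivative_diff_le:
  fixes G \<Gamma> :: "real \<Rightarrow> real"
  assumes \<Gamma>: "\<And>t. (\<Gamma> has_real_derivative G t) (at t)"
    and per: "\<And>t. G (t + 1) = G t" and nonneg: "\<And>t. 0 \<le> G t" and ab: "a \<le> b"
  shows "\<Gamma> b - \<Gamma> a \<le> (b - a + 2) * integral {0..1} G"
proof -
  have mono: "\<Gamma> s \<le> \<Gamma> t" if "s \<le> t" for s t
    by (rule DERIV_nonneg_imp_nondecreasing[OF that]) (use \<Gamma> nonneg in blast)
  have "(G has_integral (\<Gamma> 1 - \<Gamma> 0)) {0..1}"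
    by (rule fundamental_theorem_of_calculus)
       (auto simp: has_real_derivative_iff_has_vector_derivative[symmetric] intro!: has_field_derivative_at_within \<Gamma>)
  then have I: "integral {0..1} G = \<Gamma> 1 - \<Gamma> 0" by (rule integral_unique)
  define I where "I = integral {0..1} G"
  have I0: "0 \<le> I" unfolding I_def I using mono[of 0 1] by simp
  have step: "\<Gamma> (t + 1) - \<Gamma> t = I" for t
  proof -
    have "((\<lambda>t. \<Gamma> (t + 1) - \<Gamma> t) has_real_derivative 0) (at u)" for u
    proof -
      have "((\<lambda>t. \<Gamma> (t + 1)) has_real_derivative G (u + 1) * 1) (at u)"
        by (rule DERIV_chain2[OF \<Gamma>]) (auto intro!: derivative_eq_intros)
      from DERIV_diff[OF this \<Gamma>] show ?thesis by (simp add: per)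
    qed
    from DERIV_isconst_all[of "\<lambda>t. \<Gamma> (t + 1) - \<Gamma> t" t 0] this show ?thesis
      by (simp add: I_def I)
  qed
  have nat: "\<Gamma> (t + real k) - \<Gamma> t = real k * I" for t k
  proof (induction k)
    case (Suc k)
    then show ?case using step[of "t + real k"] by (simp add: algebra_simps)
  qed simp
  define n where "n = nat (\<lceil>b\<rceil> - \<lfloor>a\<rfloor>)"
  have n: "real n = of_int \<lceil>b\<rceil> - of_int \<lfloor>a\<rfloor>"
  proof -
    have "\<lfloor>a\<rfloor> \<le> \<lceil>b\<rceil>" using ab by linarith
    then show ?thesis by (simp add: n_def)
  qed
  have "\<Gamma> b - \<Gamma> a \<le> \<Gamma> (of_int \<lceil>b\<rceil>) - \<Gamma> (of_int \<lfloor>a\<rfloor>)"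
    by (intro diff_mono mono) auto
  also have "\<dots> = real n * I" using nat[of "of_int \<lfloor>a\<rfloor>" n] by (simp add: n)
  also have "\<dots> \<le> (b - a + 2) * I"
    unfolding n using I0 by (intro mult_right_mono) linarith+
  finally show ?thesis by (simp add: I_def)
qed

lemma continuous_has_antiderivative:
  fixes G :: "real \<Rightarrow> real"
  assumes "continuous_on UNIV G"
  shows "\<exists>\<Gamma>. \<forall>t. (\<Gamma> has_real_derivative G t) (at t)"
  using einterval_antiderivative[of "-\<infinity>" "\<infinity>" G] assms
  by (auto simp: has_real_derivative_iff_has_vector_derivative continuous_on_eq_continuous_at)

text \<open>As \<open>x\<close> varies, the frequencies \<open>h * p x\<close> sweep out an interval with speed at least
  \<open>h * \<kappa>1\<close>; this turns an average over tangent slopes into an integral over a full period.\<close>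

lemma integral_periodic_comp_le:
  fixes G p q :: "real \<Rightarrow> real"
  assumes cont: "continuous_on UNIV G" and per: "\<And>t. G (t + 1) = G t" and nonneg: "\<And>t. 0 \<le> G t"
    and XY: "X \<le> Y" and h: "0 < h"
    and p: "\<And>x. x \<in> {X..Y} \<Longrightarrow> (p has_real_derivative - q x) (at x)"
    and q: "\<And>x. x \<in> {X..Y} \<Longrightarrow> \<kappa>1 \<le> q x" "\<And>x. x \<in> {X..Y} \<Longrightarrow> q x \<le> \<kappa>2" and \<kappa>1: "0 < \<kappa>1"
  shows "integral {X..Y} (\<lambda>x. G (h * p x)) \<le> ((Y - X) * \<kappa>2 / \<kappa>1 + 2 / \<kappa>1 / h) * integral {0..1} G"
proof -
  obtain \<Gamma> where \<Gamma>: "\<And>t. (\<Gamma> has_real_derivative G t) (at t)"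
    using continuous_has_antiderivative[OF cont] by blast
  have "((\<lambda>x. - \<Gamma> (h * p x)) has_vector_derivative (G (h * p x) * (h * q x))) (at x within {X..Y})"
    if "x \<in> {X..Y}" for x
    unfolding has_real_derivative_iff_has_vector_derivative[symmetric]
    by (auto intro!: derivative_eq_intros DERIV_chain2[OF \<Gamma>] has_field_derivative_at_within[OF p[OF that]] simp: algebra_simps)
  then have int: "((\<lambda>x. G (h * p x) * (h * q x)) has_integral (- \<Gamma> (h * p Y) - (- \<Gamma> (h * p X)))) {X..Y}"
    by (intro fundamental_theorem_of_calculus XY)
  have contp: "continuous_on {X..Y} p"
    by (intro DERIV_continuous_on) (rule has_field_derivative_at_within[OF p])
  \<comment> \<open>Inserting the Jacobian \<open>h * q x\<close>, which is at least
    \<open>h * \<kappa>1\<close>, turns the integrand into an exact derivative.\<close>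
  have "integral {X..Y} (\<lambda>x. G (h * p x)) \<le> integral {X..Y} (\<lambda>x. (G (h * p x) * (h * q x)) / (h * \<kappa>1))"
  proof (rule integral_le)
    show "(\<lambda>x. G (h * p x)) integrable_on {X..Y}"
      by (intro integrable_continuous_real continuous_on_compose2[OF cont] continuous_intros contp) auto
    show "(\<lambda>x. (G (h * p x) * (h * q x)) / (h * \<kappa>1)) integrable_on {X..Y}"
      using int by (intro integrable_on_divide) (auto simp: has_integral_integrable)
    fix x assume x: "x \<in> {X..Y}"
    have "G (h * p x) * (h * \<kappa>1) \<le> G (h * p x) * (h * q x)"
      using q(1)[OF x] h by (intro mult_left_mono nonneg) auto
    then show "G (h * p x) \<le> (G (h * p x) * (h * q x)) / (h * \<kappa>1)"
      using h \<kappa>1 by (subst pos_le_divide_eq) auto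
  qed
  also have "\<dots> = (\<Gamma> (h * p X) - \<Gamma> (h * p Y)) / (h * \<kappa>1)"
    using integral_unique[OF has_integral_divide[OF int, of "h * \<kappa>1"]] by simp
  also have "\<dots> \<le> ((h * p X - h * p Y + 2) * integral {0..1} G) / (h * \<kappa>1)"
  proof -
    have "p Y \<le> p X"
    proof (rule DERIV_nonpos_imp_nonincreasing[OF XY])
      fix x assume "X \<le> x" "x \<le> Y"
      then show "\<exists>y. (p has_real_derivative y) (at x) \<and> y \<le> 0"
        using p[of x] q(1)[of x] \<kappa>1 by (intro exI[of _ "- q x"]) auto
    qed
    then show ?thesis
      using h \<kappa>1 by (intro divide_right_mono periodic_antiderivative_diff_le[OF \<Gamma> per nonneg]) auto
  qed
  also have "\<dots> = ((h * p X - h * p Y + 2) / (h * \<kappa>1)) * integral {0..1} G" by simp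
  also have "\<dots> \<le> ((h * ((Y - X) * \<kappa>2) + 2) / (h * \<kappa>1)) * integral {0..1} G"
  proof -
    have "(\<lambda>x. p x + \<kappa>2 * x) X \<le> (\<lambda>x. p x + \<kappa>2 * x) Y"
    proof (rule DERIV_nonneg_imp_nondecreasing[OF XY])
      fix x assume "X \<le> x" "x \<le> Y"
      then show "\<exists>y. ((\<lambda>x. p x + \<kappa>2 * x) has_real_derivative y) (at x) \<and> 0 \<le> y"
        using p[of x] q(2)[of x] by (intro exI[of _ "- q x + \<kappa>2"]) (auto intro!: derivative_eq_intros)
    qed
    then have "p X - p Y \<le> (Y - X) * \<kappa>2"
      by (simp add: algebra_simps)
    then have "h * p X - h * p Y \<le> h * ((Y - X) * \<kappa>2)"
      using h unfolding right_diff_distrib[symmetric] by (intro mult_left_mono) auto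
    moreover have "0 \<le> integral {0..1} G"
      using nonneg integrable_continuous_real[OF continuous_on_subset[OF cont]] by (intro integral_nonneg) auto
    ultimately show ?thesis
      using h \<kappa>1 by (intro mult_right_mono divide_right_mono) auto
  qed
  also have "(h * ((Y - X) * \<kappa>2) + 2) / (h * \<kappa>1) = (Y - X) * \<kappa>2 / \<kappa>1 + 2 / \<kappa>1 / h"
    using h \<kappa>1 by (simp add: field_simps)
  finally show ?thesis .
qed

definition block_sup :: "(nat \<Rightarrow> complex) \<Rightarrow> real \<Rightarrow> real \<Rightarrow> real \<Rightarrow> real \<Rightarrow> real" where
  "block_sup \<phi> X Y z \<theta> = (SUP x\<in>{X<..Y}.
     (1 / z) * cmod (\<Sum>m\<in>{m::nat. x < real m \<and> real m \<le> x + z}. \<phi> m * e (real m * \<theta>)))"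

lemma J_conv_block_sup: "J f \<phi> A z = integral {0..1} (block_sup \<phi> (f (real A)) (f (real (2 * A))) z)"
  by (simp add: J_def block_sup_def[abs_def])

lemma integral_e: "integral {0..1} (\<lambda>\<theta>. e (of_int k * \<theta>)) = (if k = 0 then 1 else 0)"
proof (cases "k = 0")
  case False
  define c where "c = 2 * pi * \<i> * complex_of_real (of_int k)"
  have c: "c \<noteq> 0" using False by (simp add: c_def)
  have eq: "e (of_int k * \<theta>) = exp (c * complex_of_real \<theta>)" for \<theta>
    by (simp add: e_def c_def mult_ac)
  have "((\<lambda>\<theta>. exp (c * complex_of_real \<theta>) / c) has_vector_derivative exp (c * complex_of_real \<theta>)) (at \<theta> within {0..1})" for \<theta>
    using c by (auto intro!: derivative_eq_intros has_vector_derivative_real_field)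
  then have "((\<lambda>\<theta>. exp (c * complex_of_real \<theta>)) has_integral
       (exp (c * complex_of_real 1) / c - exp (c * complex_of_real 0) / c)) {0..1}"
    by (intro fundamental_theorem_of_calculus) auto
  moreover have "exp (c * complex_of_real 1) = 1"
    using eq[of 1] by simp
  ultimately show ?thesis
    using False by (simp add: eq integral_unique)
qed simp

context
  fixes X Y z :: real and \<phi> :: "nat \<Rightarrow> complex"
  assumes XY: "X < Y" and z: "0 < z"
begin

text \<open>Only finitely many sets of integers occur as blocks. The supremum over \<open>x\<close>
  is therefore a maximum of finitely many continuous functions of the frequency, hence continuous
  and integrable.\<close>

definition blocks :: "nat set set" where
  "blocks = (\<lambda>x. {m::nat. x < real m \<and> real m \<le> x + z}) ` {X<..Y}"

lemma finite_blocks: "finite blocks"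
proof (rule finite_subset)
  show "blocks \<subseteq> Pow {..nat \<lfloor>Y + z\<rfloor>}"
    by (auto simp: blocks_def le_nat_floor)
qed simp

lemma blocks_nonempty: "blocks \<noteq> {}"
  using XY by (auto simp: blocks_def)

lemma block_sup_conv_Max:
  "block_sup \<phi> X Y z \<theta> = Max ((\<lambda>S. (1 / z) * cmod (\<Sum>m\<in>S. \<phi> m * e (real m * \<theta>))) ` blocks)"
proof -
  have "block_sup \<phi> X Y z \<theta> = Sup ((\<lambda>S. (1 / z) * cmod (\<Sum>m\<in>S. \<phi> m * e (real m * \<theta>))) ` blocks)"
    by (simp add: block_sup_def blocks_def image_image)
  also have "\<dots> = Max ((\<lambda>S. (1 / z) * cmod (\<Sum>m\<in>S. \<phi> m * e (real m * \<theta>))) ` blocks)"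
    using finite_blocks blocks_nonempty by (intro cSup_eq_Max) auto
  finally show ?thesis .
qed

lemma continuous_on_block_sup: "continuous_on S (block_sup \<phi> X Y z)"
proof -
  have "continuous_on S (\<lambda>\<theta>. Max ((\<lambda>B. (1 / z) * cmod (\<Sum>m\<in>B. \<phi> m * e (real m * \<theta>))) ` blocks))"
    by (rule continuous_on_Max_image[OF finite_blocks blocks_nonempty]) (intro continuous_intros)
  then show ?thesis by (simp only: block_sup_conv_Max[abs_def])
qed

lemma block_sum_le_block_sup:
  assumes "X < x" "x \<le> Y"
  shows "cmod (\<Sum>m\<in>{m::nat. x < real m \<and> real m \<le> x + z}. \<phi> m * e (real m * \<theta>)) \<le> z * block_sup \<phi> X Y z \<theta>"
proof -
  have "(1 / z) * cmod (\<Sum>m\<in>{m::nat. x < real m \<and> real m \<le> x + z}. \<phi> m * e (real m * \<theta>)) \<le> block_sup \<phi> X Y z \<theta>"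
    unfolding block_sup_conv_Max using assms finite_blocks by (intro Max_ge) (auto simp: blocks_def)
  then show ?thesis using z by (simp add: field_simps)
qed

lemma block_sup_nonneg: "0 \<le> block_sup \<phi> X Y z \<theta>"
proof -
  have "0 \<le> z * block_sup \<phi> X Y z \<theta>"
    by (rule order.trans[OF norm_ge_zero block_sum_le_block_sup[OF XY order.refl]])
  then show ?thesis using z by (simp add: zero_le_mult_iff)
qed

lemma block_sup_add_1: "block_sup \<phi> X Y z (\<theta> + 1) = block_sup \<phi> X Y z \<theta>"
proof -
  have "e (real m * (\<theta> + 1)) = e (real m * \<theta>)" for m
    using e_add_of_int[of "real m * \<theta>" "int m"] by (simp add: distrib_left)
  then show ?thesis by (simp add: block_sup_def)
qed

text \<open>Each value of \<open>\<phi>\<close> is a Fourier coefficient of a block sum.\<close>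

lemma norm_le_integral_block_sup:
  assumes m: "X < real m" "real m \<le> Y"
  shows "cmod (\<phi> m) \<le> z * integral {0..1} (block_sup \<phi> X Y z)"
proof -
  \<comment> \<open>A block containing \<open>m\<close> must start below \<open>m\<close>, not
    before \<open>m - z\<close>, and strictly to the right of \<open>X\<close>; the maximum of two
    points strictly below \<open>m\<close> meets all three conditions.\<close>
  define x where "x = max ((X + real m) / 2) (real m - z / 2)"
  define S where "S = {m::nat. x < real m \<and> real m \<le> x + z}"
  have x: "X < x" "x \<le> Y" and mS: "m \<in> S"
  proof -
    have "(X + real m) / 2 \<le> x" "real m - z / 2 \<le> x" "x < real m"
      using m z by (auto simp: x_def)
    then show "X < x" "x \<le> Y" "m \<in> S"
      using m z by (auto simp: S_def field_simps)
  qed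
  have fin: "finite S" by (simp add: S_def)
  have e_mult: "e (real n * \<theta>) * e (- real m * \<theta>) = e (of_int (int n - int m) * \<theta>)" for n \<theta>
    by (simp add: algebra_simps flip: e_add)
  have "integral {0..1} (\<lambda>\<theta>. (\<Sum>n\<in>S. \<phi> n * e (real n * \<theta>)) * e (- real m * \<theta>))
      = integral {0..1} (\<lambda>\<theta>. \<Sum>n\<in>S. \<phi> n * e (of_int (int n - int m) * \<theta>))"
    by (simp only: sum_distrib_right mult.assoc e_mult)
  also have "\<dots> = (\<Sum>n\<in>S. \<phi> n * integral {0..1} (\<lambda>\<theta>. e (of_int (int n - int m) * \<theta>)))"
    by (subst integral_sum) (auto intro!: fin integrable_continuous_real continuous_intros simp del: of_int_diff)
  also have "\<dots> = (\<Sum>n\<in>S. if n = m then \<phi> n else 0)"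
    by (intro sum.cong refl) (simp add: integral_e del: of_int_diff)
  also have "\<dots> = \<phi> m" using mS fin by simp
  finally have "cmod (\<phi> m) = cmod (integral {0..1} (\<lambda>\<theta>. (\<Sum>n\<in>S. \<phi> n * e (real n * \<theta>)) * e (- real m * \<theta>)))"
    by simp
  also have "\<dots> \<le> integral {0..1} (\<lambda>\<theta>. z * block_sup \<phi> X Y z \<theta>)"
  proof (rule integral_norm_bound_integral)
    show "(\<lambda>\<theta>. (\<Sum>n\<in>S. \<phi> n * e (real n * \<theta>)) * e (- real m * \<theta>)) integrable_on {0..1}"
      by (intro integrable_continuous_real continuous_intros)
    show "(\<lambda>\<theta>. z * block_sup \<phi> X Y z \<theta>) integrable_on {0..1}"
      by (intro integrable_continuous_real continuous_intros continuous_on_block_sup)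
    show "cmod ((\<Sum>n\<in>S. \<phi> n * e (real n * \<theta>)) * e (- real m * \<theta>)) \<le> z * block_sup \<phi> X Y z \<theta>" for \<theta>
      using block_sum_le_block_sup[OF x, of \<theta>] by (simp add: norm_mult S_def)
  qed
  finally show ?thesis by simp
qed

lemma integral_block_sup_minus:
  "integral {0..1} (\<lambda>\<theta>. block_sup \<phi> X Y z (- \<theta>)) = integral {0..1} (block_sup \<phi> X Y z)"
proof -
  have "block_sup \<phi> X Y z (- \<theta>) = block_sup \<phi> X Y z (1 - \<theta>)" for \<theta>
    using block_sup_add_1[of "- \<theta>"] by simp
  moreover have "integral {0..1} (\<lambda>\<theta>. block_sup \<phi> X Y z (1 - \<theta>)) = integral {0..1} (block_sup \<phi> X Y z)"
  proof -
    have "(block_sup \<phi> X Y z has_integral integral {0..1} (block_sup \<phi> X Y z)) (cbox 0 1)"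
      unfolding box_real by (intro integrable_integral integrable_continuous_real continuous_on_block_sup)
    from has_integral_affinity[OF this, of "-1" 1]
    have "((\<lambda>\<theta>. block_sup \<phi> X Y z (1 - \<theta>)) has_integral integral {0..1} (block_sup \<phi> X Y z)) {0..1}"
      by (simp add: image_affinity_cbox algebra_simps)
    then show ?thesis by (rule integral_unique)
  qed
  ultimately show ?thesis by simp
qed

end

section \<open>Averaging over blocks\<close>

text \<open>An integer is counted by the blocks whose start \<open>x\<close> satisfies
  \<open>m - z \<le> x < m\<close>, a set of length \<open>z\<close>. Integers in the bulk thus get
  weight exactly \<open>z\<close>; near the ends the weight lies between 0 and \<open>z\<close>, so
  the correction is at most \<open>z * W\<close> per integer.\<close>

lemma average_over_blocks:
  fixes w :: "nat \<Rightarrow> complex"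
  assumes z: "0 < z" and a: "X \<le> a" and ab: "a \<le> b" and b: "b + z \<le> Y"
    and w: "\<And>m. X < real m \<Longrightarrow> real m \<le> Y \<Longrightarrow> cmod (w m) \<le> W"
  defines "s \<equiv> \<lambda>x. \<Sum>m\<in>{m::nat. x < real m \<and> real m \<le> x + z}. w m"
  defines "T \<equiv> {m::nat. X < real m \<and> real m \<le> Y}"
  shows "s integrable_on {a..b}"
    and "cmod (\<Sum>m\<in>T. w m) \<le>
      cmod (integral {a..b} s) / z + W * real (card {m\<in>T. real m < a + z \<or> b < real m})"
proof -
  define I where "I = (\<lambda>m::nat. indicat_real {real m - z..<real m})"
  define \<mu> where "\<mu> = (\<lambda>m. integral {a..b} (I m))"
  have finT: "finite T" by (simp add: T_def)
  have lm: "{real m - z..<real m} \<inter> {a..b} \<in> lmeasurable" for m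
    by (intro bounded_set_imp_lmeasurable) (auto intro: bounded_subset[of "{a..b}"])
  then have Iint: "I m integrable_on {a..b}" for m
    unfolding I_def by (subst integrable_on_indicator)
  have \<mu>: "\<mu> m = measure lebesgue ({real m - z..<real m} \<inter> {a..b})" for m
    unfolding \<mu>_def I_def using lm by (rule integral_indicator)
  have \<mu>0: "0 \<le> \<mu> m" for m by (simp add: \<mu>)
  have \<mu>z: "\<mu> m \<le> z" for m
  proof -
    have "\<mu> m \<le> measure lebesgue {real m - z..<real m}"
      unfolding \<mu> using lm
      by (intro measure_mono_fmeasurable bounded_set_imp_lmeasurable)
         (auto intro: bounded_subset[of "{real m - z..real m}"])
    then show ?thesis using z by simp
  qed
  have \<mu>eq: "\<mu> m = z" if "a + z \<le> real m" "real m \<le> b" for m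
  proof -
    have "{real m - z..<real m} \<inter> {a..b} = {real m - z..<real m}" using that by auto
    then show ?thesis using z by (simp add: \<mu>)
  qed
  have s_eq: "s x = (\<Sum>m\<in>T. I m x *\<^sub>R w m)" if "x \<in> {a..b}" for x
  proof -
    have "(\<Sum>m\<in>T. I m x *\<^sub>R w m) = (\<Sum>m\<in>{m\<in>T. x < real m \<and> real m \<le> x + z}. w m)"
      using finT by (auto simp: I_def sum.inter_filter indicator_def if_distrib intro!: sum.cong)
    also have "{m\<in>T. x < real m \<and> real m \<le> x + z} = {m. x < real m \<and> real m \<le> x + z}"
      using that a b by (auto simp: T_def)
    finally show ?thesis by (simp add: s_def)
  qed
  have "((\<lambda>x. \<Sum>m\<in>T. I m x *\<^sub>R w m) has_integral (\<Sum>m\<in>T. \<mu> m *\<^sub>R w m)) {a..b}"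
    unfolding \<mu>_def
    by (intro has_integral_sum finT has_integral_scaleR_left integrable_integral Iint)
  then have int: "(s has_integral (\<Sum>m\<in>T. \<mu> m *\<^sub>R w m)) {a..b}"
    by (rule has_integral_eq_rhs[OF has_integral_eq[rotated]]) (auto simp: s_eq)
  then show "s integrable_on {a..b}" by (rule has_integral_integrable)
  define B where "B = {m\<in>T. real m < a + z \<or> b < real m}"
  have "z *\<^sub>R (\<Sum>m\<in>T. w m) = integral {a..b} s + (\<Sum>m\<in>T. (z - \<mu> m) *\<^sub>R w m)"
    using int by (simp add: integral_unique scaleR_sum_right sum.distrib[symmetric] scaleR_left_diff_distrib)
  also have "(\<Sum>m\<in>T. (z - \<mu> m) *\<^sub>R w m) = (\<Sum>m\<in>B. (z - \<mu> m) *\<^sub>R w m)"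
    by (rule sum.mono_neutral_right) (use finT \<mu>eq in \<open>auto simp: B_def not_less\<close>)
  finally have "z * cmod (\<Sum>m\<in>T. w m) = cmod (integral {a..b} s + (\<Sum>m\<in>B. (z - \<mu> m) *\<^sub>R w m))"
    using z by (metis norm_scaleR abs_of_pos)
  also have "\<dots> \<le> cmod (integral {a..b} s) + cmod (\<Sum>m\<in>B. (z - \<mu> m) *\<^sub>R w m)"
    by (rule norm_triangle_ineq)
  also have "cmod (\<Sum>m\<in>B. (z - \<mu> m) *\<^sub>R w m) \<le> (\<Sum>m\<in>B. z * W)"
  proof (rule sum_norm_le)
    fix m assume "m \<in> B"
    then have "cmod (w m) \<le> W" using w by (auto simp: B_def T_def)
    then show "cmod ((z - \<mu> m) *\<^sub>R w m) \<le> z * W"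
      using \<mu>0[of m] \<mu>z[of m] z by (auto intro!: mult_mono)
  qed
  finally have "z * cmod (\<Sum>m\<in>T. w m) \<le> cmod (integral {a..b} s) + z * (W * real (card B))"
    by (simp add: mult_ac)
  then show "cmod (\<Sum>m\<in>T. w m) \<le>
      cmod (integral {a..b} s) / z + W * real (card {m\<in>T. real m < a + z \<or> b < real m})"
    using z unfolding B_def[symmetric] by (simp add: field_simps)
qed

text \<open>Concavity puts \<open>g\<close> below its tangent, so the error is one-sided, as
  \<open>ceiling_perturbation_fejer\<close> requires. Two applications of the mean value theorem
  give the quadratic error without the factor 1/2.\<close>

lemma tangent_bounds:
  fixes g p q :: "real \<Rightarrow> real"
  assumes g: "\<And>u. u \<in> {x..y} \<Longrightarrow> (g has_real_derivative p u) (at u)"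
    and p: "\<And>u. u \<in> {x..y} \<Longrightarrow> (p has_real_derivative - q u) (at u)"
    and q: "\<And>u. u \<in> {x..y} \<Longrightarrow> 0 \<le> q u" "\<And>u. u \<in> {x..y} \<Longrightarrow> q u \<le> \<kappa>" and xy: "x \<le> y"
  shows "p y \<le> p x" "p x - p y \<le> \<kappa> * (y - x)"
    "g y \<le> g x + p x * (y - x)" "g x + p x * (y - x) - \<kappa> * (y - x)\<^sup>2 \<le> g y"
proof -
  have pb: "p u \<le> p x \<and> p x - p u \<le> \<kappa> * (u - x)" if u: "u \<in> {x..y}" for u
  proof (cases "u = x")
    case False
    then have "x < u" using u by simp
    then obtain v where v: "x < v" "v < u" "p u - p x = (u - x) * - q v"
      using MVT2[of x u p "\<lambda>u. - q u"] p u by auto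
    have "0 \<le> (u - x) * q v" "(u - x) * q v \<le> (u - x) * \<kappa>"
      using q[of v] v u by (auto intro!: mult_left_mono)
    then show ?thesis using v(3) by (simp add: mult_ac)
  qed simp
  show "p y \<le> p x" "p x - p y \<le> \<kappa> * (y - x)" using pb[of y] xy by auto
  show "g y \<le> g x + p x * (y - x)" "g x + p x * (y - x) - \<kappa> * (y - x)\<^sup>2 \<le> g y"
  proof (atomize (full), cases "y = x")
    case False
    then have "x < y" using xy by simp
    then obtain v where v: "x < v" "v < y" "g y - g x = (y - x) * p v"
      using MVT2[of x y g p] g by auto
    have \<kappa>: "0 \<le> \<kappa>" using q[of x] xy by force
    have "(y - x) * p v \<le> (y - x) * p x"
      using pb[of v] v by (intro mult_left_mono) auto
    moreover have "(y - x) * (p x - p v) \<le> (y - x) * (\<kappa> * (y - x))"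
    proof (intro mult_left_mono)
      have "\<kappa> * (v - x) \<le> \<kappa> * (y - x)" using v \<kappa> by (intro mult_left_mono) auto
      then show "p x - p v \<le> \<kappa> * (y - x)" using pb[of v] v by auto
    qed (use xy in auto)
    ultimately show "g y \<le> g x + p x * (y - x) \<and> g x + p x * (y - x) - \<kappa> * (y - x)\<^sup>2 \<le> g y"
      using v(3) by (simp add: algebra_simps power2_eq_square)
  qed auto
qed

text \<open>Here \<open>p\<close> and \<open>q\<close> play \<open>g'\<close> and
  \<open>- g''\<close>, and \<nu> the number of preimages. The four terms stem from the integers
  near the ends, the variation of \<open>p\<close> inside a block, the block sums of
  \<open>\<phi>\<close>, and the kernel errors; \<open>V k\<close> bounds the integral of
  \<open>fejer_bound z k (p x)\<close>. At the last integers \<nu> need not be a ceiling difference,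
  so only \<open>\<bar>\<nu> - p\<bar> \<le> 1\<close> is used near the ends.\<close>

lemma core_estimate:
  fixes g p q \<nu> :: "real \<Rightarrow> real" and \<phi> :: "nat \<Rightarrow> complex"
  assumes X: "0 \<le> X" and z: "2 \<le> z" and XY: "X + z + 2 \<le> Y"
    and g: "\<And>u. u \<in> {X..Y} \<Longrightarrow> (g has_real_derivative p u) (at u)"
    and p: "\<And>u. u \<in> {X..Y} \<Longrightarrow> (p has_real_derivative - q u) (at u)"
    and q: "\<And>u. u \<in> {X..Y} \<Longrightarrow> \<kappa>1 \<le> q u" "\<And>u. u \<in> {X..Y} \<Longrightarrow> q u \<le> \<kappa>2" and \<kappa>1: "0 < \<kappa>1"
    and p0: "\<And>u. u \<in> {X..Y} \<Longrightarrow> 0 \<le> p u" and p_le: "\<And>u. u \<in> {X..Y} \<Longrightarrow> p u \<le> \<Lambda>"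
    and \<phi>: "\<And>m. X < real m \<Longrightarrow> real m \<le> Y \<Longrightarrow> cmod (\<phi> m) \<le> M" and M: "0 \<le> M"
    and \<nu>: "\<And>m::nat. X < real m \<Longrightarrow> real m + 1 \<le> Y \<Longrightarrow>
              \<nu> (real m) = of_int \<lceil>g (real m + 1)\<rceil> - of_int \<lceil>g (real m)\<rceil>"
    and \<nu>p: "\<And>m::nat. X < real m \<Longrightarrow> real m \<le> Y \<Longrightarrow> \<bar>\<nu> (real m) - p (real m)\<bar> \<le> 1"
    and N: "N > 0" and N1: "N1 > 0" and \<delta>: "6 * (\<kappa>2 * (z + 1)\<^sup>2) * real N1 \<le> 1"
  defines "\<alpha> \<equiv> (Y - X) * \<kappa>2 / \<kappa>1" and "\<beta> \<equiv> 2 / \<kappa>1"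
  defines "V \<equiv> \<lambda>k. ((Y - X) * (z + 1) + 2 * (\<Sum>h=1..<k. (\<alpha> + \<beta> / real h) * (2 * ln (2 * z + 3)))) / real k"
  shows "cmod (\<Sum>m\<in>{m::nat. X < real m \<and> real m \<le> Y}. \<phi> m * complex_of_real (\<nu> (real m) - p (real m)))
     \<le> 4 * z * M + M * ((z + 1) * \<kappa>2 * (Y - X))
       + 4 * (\<Sum>h=1..<N. min \<Lambda> (1 / real h) * (\<alpha> + \<beta> / real h)) * integral {0..1} (block_sup \<phi> X Y z)
       + M / z * (8 * V N1 + 24 * ((\<Sum>k=1..N. V k) / real N))"
proof -
  \<comment> \<open>The margins ensure \<open>x > X\<close>, as \<open>block_sup\<close> demands,
    and \<open>m + 1 \<le> Y\<close> for every \<open>m\<close> of a block, so that its tangent and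
    the formula for \<nu> are available throughout.\<close>
  define a where "a = X + 1"
  define b where "b = Y - z - 1"
  have ab: "a \<le> b" "X < a" "b + z + 1 = Y" "b < Y" "0 \<le> a"
    using XY z X by (simp_all add: a_def b_def)
  have sub: "{a..b} \<subseteq> {X..Y}" using ab z by auto
  have z0: "0 < z" "0 \<le> z" using z by auto
  have XY': "X < Y" using XY z by simp
  have \<kappa>2: "0 \<le> \<kappa>2" using q[of X] \<kappa>1 XY' by force
  define K where "K = block_sup \<phi> X Y z"
  define \<J> where "\<J> = integral {0..1} K"
  have contK: "continuous_on S K" for S unfolding K_def by (rule continuous_on_block_sup[OF XY' z0(1)])
  have K0: "0 \<le> K \<theta>" for \<theta> unfolding K_def by (rule block_sup_nonneg[OF XY' z0(1)])
  have K1: "K (\<theta> + 1) = K \<theta>" for \<theta> unfolding K_def by (rule block_sup_add_1[OF XY' z0(1)])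
  have contp: "continuous_on {a..b} p"
    by (intro DERIV_continuous_on) (rule has_field_derivative_at_within[OF p], use sub in auto)
  have comp: "continuous_on {a..b} (\<lambda>x. G (c * p x))" if "continuous_on UNIV G" for G :: "real \<Rightarrow> real" and c
    by (intro continuous_on_compose2[OF that] continuous_intros contp) auto
  have intG: "integral {a..b} (\<lambda>x. G (real h * p x)) \<le> (\<alpha> + \<beta> / real h) * integral {0..1} G"
    if "continuous_on UNIV G" "\<And>t. G (t + 1) = G t" "\<And>t. 0 \<le> G t" "h \<ge> 1" for G and h :: nat
  proof -
    have "integral {a..b} (\<lambda>x. G (real h * p x)) \<le> ((b - a) * \<kappa>2 / \<kappa>1 + 2 / \<kappa>1 / real h) * integral {0..1} G"
      using that ab sub q p \<kappa>1 by (intro integral_periodic_comp_le[where q=q]) auto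
    also have "\<dots> \<le> (\<alpha> + \<beta> / real h) * integral {0..1} G"
    proof (rule mult_right_mono)
      have "(b - a) * \<kappa>2 / \<kappa>1 \<le> \<alpha>"
        unfolding \<alpha>_def using ab z \<kappa>1 \<kappa>2 by (intro divide_right_mono mult_right_mono) auto
      then show "(b - a) * \<kappa>2 / \<kappa>1 + 2 / \<kappa>1 / real h \<le> \<alpha> + \<beta> / real h" by (simp add: \<beta>_def)
      show "0 \<le> integral {0..1} G"
        using that by (intro integral_nonneg integrable_continuous_real) (auto intro: continuous_on_subset)
    qed
    finally show ?thesis .
  qed
  \<comment> \<open>Real sines produce both signs of each frequency; symmetrising gives one
    nonnegative periodic function to which the averaging applies.\<close>
  define K2 where "K2 = (\<lambda>\<theta>. K \<theta> + K (- \<theta>))"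
  have contK2: "continuous_on UNIV K2"
    unfolding K2_def by (intro continuous_intros contK continuous_on_compose2[OF contK[of UNIV]]) auto
  have K21: "K2 (\<theta> + 1) = K2 \<theta>" for \<theta>
    using K1[of \<theta>] K1[of "- \<theta> - 1"] by (simp add: K2_def)
  have intK2: "integral {0..1} K2 = 2 * \<J>"
  proof -
    have "integral {0..1} K2 = \<J> + integral {0..1} (\<lambda>\<theta>. K (- \<theta>))"
      unfolding K2_def \<J>_def
      by (intro integral_add integrable_continuous_real continuous_intros contK continuous_on_compose2[OF contK[of UNIV]]) auto
    then show ?thesis
      using integral_block_sup_minus[OF XY' z0(1), of \<phi>] by (simp add: K_def \<J>_def)
  qed
  define w where "w = (\<lambda>m::nat. \<phi> m * complex_of_real (\<nu> (real m) - p (real m)))"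
  define s where "s = (\<lambda>x. \<Sum>m\<in>{m::nat. x < real m \<and> real m \<le> x + z}. w m)"
  define F where "F = (\<lambda>x. M * ((z + 1) * \<kappa>2 * z)
      + 2 * (\<Sum>h=1..<N. min \<Lambda> (1 / real h) * (z * K2 (real h * p x)))
      + M * (8 * fejer_bound z N1 (p x) + 24 * ((\<Sum>k=1..N. fejer_bound z k (p x)) / real N)))"
  have sF: "cmod (s x) \<le> F x" if x: "x \<in> {a..b}" for x
  proof -
    define S where "S = {m::nat. x < real m \<and> real m \<le> x + z}"
    define T where "T = (\<lambda>\<theta>. cmod (\<Sum>m\<in>S. \<phi> m * e (real m * \<theta>)))"
    have xX: "X < x" "x \<le> Y" "0 \<le> x" "x \<in> {X..Y}" using x ab by auto
    have inT: "X < real m" "real m \<le> Y" "real m + 1 \<le> Y" if "m \<in> S" for m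
      using that x ab by (auto simp: S_def)
    have tb: "p (real m) \<le> p x" "p x - p (real m) \<le> \<kappa>2 * (real m - x)"
      "g (real m) \<le> g x + p x * (real m - x)" "g x + p x * (real m - x) - \<kappa>2 * (real m - x)\<^sup>2 \<le> g (real m)"
      if "x < real m" "real m \<le> x + z + 1" for m
    proof -
      have *: "u \<in> {X..Y}" if "u \<in> {x..real m}" for u
        using that \<open>real m \<le> x + z + 1\<close> x ab by auto
      have q': "0 \<le> q u" if "u \<in> {x..real m}" for u using q(1)[OF *[OF that]] \<kappa>1 by simp
      note tb = tangent_bounds[OF g[OF *] p[OF *] q' q(2)[OF *], of x "real m"]
      show "p (real m) \<le> p x" "p x - p (real m) \<le> \<kappa>2 * (real m - x)"
        "g (real m) \<le> g x + p x * (real m - x)" "g x + p x * (real m - x) - \<kappa>2 * (real m - x)\<^sup>2 \<le> g (real m)"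
        using tb that by auto
    qed
    have "cmod (\<Sum>m\<in>S. \<phi> m * complex_of_real (of_int \<lceil>g (real m + 1)\<rceil> - of_int \<lceil>g (real m)\<rceil> - p x))
       \<le> 2 * (\<Sum>h=1..<N. min (p x) (1 / real h) * (T (real h * p x) + T (- (real h * p x))))
         + M * (8 * fejer_bound z N1 (p x) + 24 * ((\<Sum>k=1..N. fejer_bound z k (p x)) / real N))"
      unfolding T_def S_def
    proof (rule block_estimate[OF xX(3) z0(2) N N1 p0[OF xX(4)] \<delta>, where c="g x - p x * x"])
      fix m :: nat assume m: "x < real m" "real m \<le> x + z + 1"
      have "\<kappa>2 * (real m - x)\<^sup>2 \<le> \<kappa>2 * (z + 1)\<^sup>2"
        using m \<kappa>2 by (intro mult_left_mono power_mono) auto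
      then show "g x - p x * x + p x * real m - \<kappa>2 * (z + 1)\<^sup>2 \<le> g (real m) \<and> g (real m) \<le> g x - p x * x + p x * real m"
        using tb(3,4)[OF m] by (simp add: algebra_simps)
    next
      fix m :: nat assume "x < real m" "real m \<le> x + z"
      then show "cmod (\<phi> m) \<le> M" using inT[of m] by (intro \<phi>) (auto simp: S_def)
    qed (rule M)
    also have "\<dots> \<le> 2 * (\<Sum>h=1..<N. min \<Lambda> (1 / real h) * (z * K2 (real h * p x)))
         + M * (8 * fejer_bound z N1 (p x) + 24 * ((\<Sum>k=1..N. fejer_bound z k (p x)) / real N))"
    proof -
      have "T \<theta> \<le> z * K \<theta>" for \<theta>
        unfolding T_def S_def K_def by (rule block_sum_le_block_sup[OF XY' z0(1) xX(1,2)])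
      then have "T \<theta> + T (- \<theta>) \<le> z * K2 \<theta>" for \<theta>
        by (simp add: K2_def distrib_left add_mono)
      moreover have "0 \<le> T \<theta>" for \<theta> by (simp add: T_def)
      ultimately show ?thesis
        using p_le[OF xX(4)] p0[OF xX(4)] by (intro add_right_mono mult_left_mono sum_mono mult_mono) auto
    qed
    finally have 1: "cmod (\<Sum>m\<in>S. \<phi> m * complex_of_real (of_int \<lceil>g (real m + 1)\<rceil> - of_int \<lceil>g (real m)\<rceil> - p x)) \<le> \<dots>" .
    \<comment> \<open>The slope at the start of the block replaces \<open>p m\<close>: at most
      \<open>z + 1\<close> terms, each changed by at most \<open>\<kappa>2 * z\<close>.\<close>
    have "cmod (\<Sum>m\<in>S. \<phi> m * complex_of_real (p x - p (real m))) \<le> (\<Sum>m\<in>S. M * (\<kappa>2 * z))"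
    proof (rule sum_norm_le)
      fix m assume m: "m \<in> S"
      have "\<bar>p x - p (real m)\<bar> \<le> \<kappa>2 * z"
      proof -
        have "\<kappa>2 * (real m - x) \<le> \<kappa>2 * z" using m \<kappa>2 by (intro mult_left_mono) (auto simp: S_def)
        then show ?thesis using tb(1,2)[of m] m by (auto simp: S_def)
      qed
      then show "cmod (\<phi> m * complex_of_real (p x - p (real m))) \<le> M * (\<kappa>2 * z)"
        unfolding norm_mult norm_of_real using \<phi>[of m] inT[OF m] M by (intro mult_mono) auto
    qed
    also have "\<dots> = real (card S) * (M * (\<kappa>2 * z))" by simp
    also have "\<dots> \<le> (z + 1) * (M * (\<kappa>2 * z))"
      using card_integer_block_le[of x "x + z"] xX z0 M \<kappa>2 by (intro mult_right_mono) (auto simp: S_def)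
    finally have 2: "cmod (\<Sum>m\<in>S. \<phi> m * complex_of_real (p x - p (real m))) \<le> M * ((z + 1) * \<kappa>2 * z)"
      by (simp add: mult_ac)
    have "s x = (\<Sum>m\<in>S. \<phi> m * complex_of_real (of_int \<lceil>g (real m + 1)\<rceil> - of_int \<lceil>g (real m)\<rceil> - p x))
        + (\<Sum>m\<in>S. \<phi> m * complex_of_real (p x - p (real m)))"
      unfolding s_def S_def[symmetric] w_def sum.distrib[symmetric]
    proof (intro sum.cong refl)
      fix m assume m: "m \<in> S"
      have "\<nu> (real m) - p (real m) =
          (of_int \<lceil>g (real m + 1)\<rceil> - of_int \<lceil>g (real m)\<rceil> - p x) + (p x - p (real m))"
        using \<nu>[OF inT(1,3)[OF m]] by simp
      then show "\<phi> m * complex_of_real (\<nu> (real m) - p (real m)) =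
          \<phi> m * complex_of_real (of_int \<lceil>g (real m + 1)\<rceil> - of_int \<lceil>g (real m)\<rceil> - p x)
          + \<phi> m * complex_of_real (p x - p (real m))"
        by (simp only: of_real_add distrib_left)
    qed
    then show ?thesis
      using norm_triangle_mono[OF 1 2] by (simp add: F_def algebra_simps)
  qed
  define D where "D = integral {0..1} (geom_bound z)"
  have contfb: "continuous_on {a..b} (\<lambda>x. fejer_bound z k (p x))" for k
    unfolding fejer_bound_def divide_inverse
    by (intro continuous_intros comp continuous_on_geom_bound z0)
  have intfb: "integral {a..b} (\<lambda>x. fejer_bound z k (p x)) \<le> V k" for k
  proof -
    have "integral {a..b} (\<lambda>x. fejer_bound z k (p x)) =
       ((b - a) * (z + 1) + 2 * (\<Sum>h=1..<k. integral {a..b} (\<lambda>x. geom_bound z (real h * p x)))) / real k"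
    proof (rule integral_unique)
      have "((\<lambda>x. (z + 1 + 2 * (\<Sum>h=1..<k. geom_bound z (real h * p x))) / real k) has_integral
         (((b - a) * (z + 1) + 2 * (\<Sum>h=1..<k. integral {a..b} (\<lambda>x. geom_bound z (real h * p x)))) / real k)) {a..b}"
        using has_integral_const_real[of "z + 1" a b] ab
        by (intro has_integral_divide has_integral_add has_integral_mult_right has_integral_sum
              integrable_integral integrable_continuous_real comp continuous_on_geom_bound z0) auto
      then show "((\<lambda>x. fejer_bound z k (p x)) has_integral
         (((b - a) * (z + 1) + 2 * (\<Sum>h=1..<k. integral {a..b} (\<lambda>x. geom_bound z (real h * p x)))) / real k)) {a..b}"
        by (simp add: fejer_bound_def)
    qed
    also have "\<dots> \<le> V k"
      unfolding V_def
    proof (intro divide_right_mono add_mono mult_left_mono mult_right_mono sum_mono)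
      fix h assume "h \<in> {1..<k}"
      then have "integral {a..b} (\<lambda>x. geom_bound z (real h * p x)) \<le> (\<alpha> + \<beta> / real h) * D"
        unfolding D_def by (intro intG continuous_on_geom_bound z0 geom_bound_add_1 geom_bound_nonneg) auto
      also have "\<dots> \<le> (\<alpha> + \<beta> / real h) * (2 * ln (2 * z + 3))"
        unfolding D_def \<alpha>_def \<beta>_def using XY' \<kappa>1 \<kappa>2
        by (intro mult_left_mono integral_geom_bound_le z0) auto
      finally show "integral {a..b} (\<lambda>x. geom_bound z (real h * p x)) \<le> (\<alpha> + \<beta> / real h) * (2 * ln (2 * z + 3))" .
    qed (use ab z0 in auto)
    finally show ?thesis .
  qed
  have contK2h: "continuous_on {a..b} (\<lambda>x. K2 (real h * p x))" for h
    by (rule comp[OF contK2])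
  have Fint: "F integrable_on {a..b}"
    unfolding F_def divide_inverse
    by (intro integrable_continuous_real continuous_intros contK2h contfb)
  have FI: "integral {a..b} F = (b - a) * (M * ((z + 1) * \<kappa>2 * z))
      + 2 * (\<Sum>h=1..<N. min \<Lambda> (1 / real h) * (z * integral {a..b} (\<lambda>x. K2 (real h * p x))))
      + M * (8 * integral {a..b} (\<lambda>x. fejer_bound z N1 (p x))
           + 24 * ((\<Sum>k=1..N. integral {a..b} (\<lambda>x. fejer_bound z k (p x))) / real N))"
    unfolding F_def
    using has_integral_const_real[of "M * ((z + 1) * \<kappa>2 * z)" a b] ab
    by (intro integral_unique has_integral_divide has_integral_add has_integral_mult_right has_integral_sum
          integrable_integral integrable_continuous_real contK2h contfb) auto
  have "integral {a..b} F \<le> (Y - X) * (M * ((z + 1) * \<kappa>2 * z))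
      + 2 * (\<Sum>h=1..<N. min \<Lambda> (1 / real h) * (z * ((\<alpha> + \<beta> / real h) * (2 * \<J>))))
      + M * (8 * V N1 + 24 * ((\<Sum>k=1..N. V k) / real N))"
    unfolding FI
  proof (intro add_mono mult_mono[of "b - a"] mult_left_mono sum_mono divide_right_mono intfb M)
    fix h assume "h \<in> {1..<N}"
    then show "integral {a..b} (\<lambda>x. K2 (real h * p x)) \<le> (\<alpha> + \<beta> / real h) * (2 * \<J>)"
      unfolding intK2[symmetric] by (intro intG contK2 K21) (auto simp: K2_def K0)
    show "0 \<le> min \<Lambda> (1 / real h)"
      using p0[of X] p_le[of X] XY' by auto
  qed (use ab z0 \<kappa>2 M in auto)
  also have "\<dots> = z * (M * ((z + 1) * \<kappa>2 * (Y - X))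
       + 4 * (\<Sum>h=1..<N. min \<Lambda> (1 / real h) * (\<alpha> + \<beta> / real h)) * \<J>
       + M / z * (8 * V N1 + 24 * ((\<Sum>k=1..N. V k) / real N)))"
  proof -
    have "(\<Sum>h=1..<N. min \<Lambda> (1 / real h) * (z * ((\<alpha> + \<beta> / real h) * (2 * \<J>)))) =
        2 * z * \<J> * (\<Sum>h=1..<N. min \<Lambda> (1 / real h) * (\<alpha> + \<beta> / real h))"
      unfolding sum_distrib_left by (intro sum.cong refl) (simp add: algebra_simps)
    then show ?thesis using z0 by (simp add: algebra_simps)
  qed
  finally have "integral {a..b} F / z \<le> M * ((z + 1) * \<kappa>2 * (Y - X))
       + 4 * (\<Sum>h=1..<N. min \<Lambda> (1 / real h) * (\<alpha> + \<beta> / real h)) * \<J>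
       + M / z * (8 * V N1 + 24 * ((\<Sum>k=1..N. V k) / real N))"
    using z0 by (simp add: pos_divide_le_eq mult.commute)
  moreover have wM: "cmod (w m) \<le> M" if "X < real m" "real m \<le> Y" for m
    unfolding w_def norm_mult norm_of_real
    using mult_mono[OF \<phi>[OF that] \<nu>p[OF that] M] by simp
  note avg = average_over_blocks[where w=w and W=M, OF z0(1) less_imp_le[OF ab(2)] ab(1) _ wM]
  have bz: "b + z \<le> Y" using ab by simp
  have "cmod (integral {a..b} s) \<le> integral {a..b} F"
    using sF avg(1)[OF bz] Fint by (intro integral_norm_bound_integral) (auto simp: s_def)
  then have "cmod (integral {a..b} s) / z \<le> integral {a..b} F / z"
    using z0 by (intro divide_right_mono) auto
  moreover have "M * real (card {m\<in>{m::nat. X < real m \<and> real m \<le> Y}. real m < a + z \<or> b < real m}) \<le> M * (4 * z)"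
  proof (intro mult_left_mono M)
    have "card {m\<in>{m::nat. X < real m \<and> real m \<le> Y}. real m < a + z \<or> b < real m} \<le>
        card ({m::nat. X < real m \<and> real m \<le> a + z} \<union> {m::nat. b < real m \<and> real m \<le> Y})"
      by (intro card_mono) auto
    also have "\<dots> \<le> card {m::nat. X < real m \<and> real m \<le> a + z} + card {m::nat. b < real m \<and> real m \<le> Y}"
      by (rule card_Un_le)
    finally have "real (card {m\<in>{m::nat. X < real m \<and> real m \<le> Y}. real m < a + z \<or> b < real m}) \<le>
        real (card {m::nat. X < real m \<and> real m \<le> a + z}) + real (card {m::nat. b < real m \<and> real m \<le> Y})"
      by linarith
    also have "\<dots> \<le> (a + z - X + 1) + (Y - b + 1)"
      using ab X z0 by (intro add_mono card_integer_block_le) auto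
    \<comment> \<open>The total is \<open>2 * z + 4\<close>, so \<open>z \<ge> 2\<close>
      suffices.\<close>
    also have "\<dots> \<le> 4 * z" using z by (simp add: a_def b_def)
    finally show "real (card {m\<in>{m::nat. X < real m \<and> real m \<le> Y}. real m < a + z \<or> b < real m}) \<le> 4 * z" .
  qed
  ultimately show ?thesis
    using avg(2)[OF bz] unfolding w_def[symmetric] s_def[symmetric] \<J>_def K_def by (simp add: mult_ac)
qed

section \<open>Choice of the kernel degree and numerical evaluation of the averaged bound\<close>

lemma sum_inverse_le_ln:
  assumes "k \<le> N" "N \<ge> 1"
  shows "(\<Sum>h=1..k. 1 / real h) \<le> 1 + ln (real N)"
proof -
  obtain n where n: "N = Suc n" using assms by (cases N) auto
  have "(\<Sum>h=1..k. 1 / real h) \<le> (\<Sum>h=1..N. 1 / real h)"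
    using assms by (intro sum_mono2) auto
  also have "\<dots> = harm N" by (simp add: harm_def divide_inverse)
  also have "harm N \<le> 1 + ln (real N)"
    using decseqD[OF decseq_harm_diff_ln, of 0 n] by (simp add: n harm_expand)
  finally show ?thesis .
qed

text \<open>The degree is about \<open>1 / (6 * \<delta>)\<close>, the largest that the perturbation
  lemma tolerates, but never more than \<open>N\<close>. Rounding down loses at most a factor 2,
  whence 12.\<close>

lemma exists_kernel_degree:
  fixes \<delta> :: real
  assumes "0 < \<delta>" "6 * \<delta> \<le> 1" "N > 0"
  shows "\<exists>k::nat. 0 < k \<and> k \<le> N \<and> 6 * \<delta> * real k \<le> 1 \<and> 1 / real k \<le> 12 * \<delta> + 1 / real N"
proof (cases "6 * \<delta> * real N \<le> 1")
  case True
  with assms show ?thesis by (intro exI[of _ N]) auto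
next
  case False
  define k where "k = nat \<lfloor>1 / (6 * \<delta>)\<rfloor>"
  have "1 / (6 * \<delta>) \<ge> 1" using assms by simp
  then have "k \<ge> 1" "real k \<le> 1 / (6 * \<delta>)" "1 / (6 * \<delta>) < real k + 1"
    unfolding k_def by linarith+
  then have k: "k > 0" "real k \<le> 1 / (6 * \<delta>)" "1 / (6 * \<delta>) \<le> 2 * real k"
    by linarith+
  have 1: "6 * \<delta> * real k \<le> 1" using k(2) assms by (simp add: field_simps)
  have "6 * \<delta> * real k < 6 * \<delta> * real N" using 1 False by linarith
  then have "k \<le> N" using assms by simp
  moreover have "1 / real k \<le> 12 * \<delta> + 1 / real N"
    using k assms by (intro add_increasing2) (auto simp: field_simps)
  ultimately show ?thesis using k 1 by blast
qed

text \<open>Pure bookkeeping, with \<open>F1\<close>, \<open>F2\<close>, \<open>L\<close>,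
  \<open>R\<close> standing for \<open>f' A\<close>, \<open>f'' A\<close>, \<open>ln A\<close> and
  the length of the range. Every term is sorted into \<open>P = F2 / F1^2 * z^2\<close> or
  \<open>Q = F1 * L^3 * \<J>\<close>. Terms with a factor \<open>M / z\<close> go to
  \<open>Q\<close> because \<open>M \<le> z * \<J>\<close>; terms that already have the size of
  \<open>P\<close> use \<open>M \<le> 1\<close>.\<close>

lemma core_bound_numeric:
  fixes A F1 F2 L z R K c2 C1 C2 M \<J> \<kappa>1 \<kappa>2 :: real and N N1 :: nat
  assumes pos: "0 < A" "1 \<le> F1" "0 < F2" "1/2 \<le> L" "2 \<le> z" "0 \<le> R" "1 \<le> K" "1 \<le> c2" "0 \<le> C1" "0 \<le> C2"
    and M: "0 \<le> M" "M \<le> 1" "M \<le> z * \<J>" and J: "0 \<le> \<J>"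
    and R: "R \<le> K * A * F1"
    and \<kappa>: "\<kappa>1 = F2 / (2 * K^3 * F1^3)" "\<kappa>2 = c2 * F2 / F1^3"
    and F1: "F1 \<le> C1 * A * F2 * L" "F1 \<le> z" "F1 * L \<le> z"
    and N: "z \<le> real N" "1 + ln (real N) \<le> C2 * L" "ln (2 * z + 3) \<le> C2 * L"
    and N1: "0 < N1" "N1 \<le> N" "1 / real N1 \<le> 12 * (\<kappa>2 * (z + 1)\<^sup>2) + 1 / real N"
    and \<delta>: "6 * (\<kappa>2 * (z + 1)\<^sup>2) * F1 \<le> 1"
  defines "\<alpha> \<equiv> R * \<kappa>2 / \<kappa>1" and "\<beta> \<equiv> 2 / \<kappa>1"
  defines "V \<equiv> \<lambda>k. (R * (z + 1) + 2 * (\<Sum>h=1..<k. (\<alpha> + \<beta> / real h) * (2 * ln (2 * z + 3)))) / real k"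
  defines "C3 \<equiv> 4 * c2 * K^4 + 4 * K^3 * C1"
  shows "4 * z * M + M * ((z + 1) * \<kappa>2 * R)
       + 4 * (\<Sum>h=1..<N. min (1 / F1) (1 / real h) * (\<alpha> + \<beta> / real h)) * \<J>
       + M / z * (8 * V N1 + 24 * ((\<Sum>k=1..N. V k) / real N))
    \<le> A * ((4 * C1 + 2 * c2 * K + 768 * K * c2) * (F2 / F1\<^sup>2 * z\<^sup>2)
          + (16 * C3 * C2 + 8 * (16 * K + 4 * C2 * C3 * (2 + 3 * C2))
             + 24 * (8 * K * C2 + 4 * C2^3 * C3 + 8 * C2 * C3)) * (F1 * L^3 * \<J>))"
proof -
  define P where "P = F2 / F1\<^sup>2 * z\<^sup>2"
  define Q where "Q = F1 * L^3 * \<J>"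
  define H where "H = C2 * L"
  \<comment> \<open>Common size of \<alpha> and \<open>\<beta> / F1\<close>. The factor
    \<open>L\<close> is forced by \<beta>, through \<open>F1 \<le> C1 * A * F2 * L\<close>; for
    \<alpha> it is merely tolerated.\<close>
  define \<gamma> where "\<gamma> = A * F1 * L * C3"
  define \<delta>' where "\<delta>' = \<kappa>2 * (z + 1)\<^sup>2"
  have F1p: "0 < F1" and Lp: "0 < L" and zp: "0 < z" and Np: "0 < real N" "1 \<le> N"
    using pos N by auto
  have \<kappa>p: "0 < \<kappa>1" "0 < \<kappa>2" using pos F1p unfolding \<kappa> by auto
  have C3: "0 \<le> C3" using pos by (simp add: C3_def)
  have H: "0 \<le> H" using pos by (simp add: H_def)
  have \<gamma>: "0 \<le> \<gamma>" using pos C3 by (simp add: \<gamma>_def)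
  have PQ: "0 \<le> P" "0 \<le> Q" using pos J by (auto simp: P_def Q_def)
  have Mz: "M / z \<le> \<J>" "0 \<le> M / z" using M zp by (auto simp: field_simps)
  have L23: "L\<^sup>2 \<le> 2 * L^3" "L \<le> 4 * L^3" "1 \<le> 8 * L^3"
  proof -
    have "(1/2) * L\<^sup>2 \<le> L * L\<^sup>2" using pos by (intro mult_right_mono) auto
    then show 1: "L\<^sup>2 \<le> 2 * L^3" by (simp add: power2_eq_square power3_eq_cube)
    have "(1/2) * L \<le> L * L" using pos by (intro mult_right_mono) auto
    then show 2: "L \<le> 4 * L^3" using 1 by (simp add: power2_eq_square)
    then show "1 \<le> 8 * L^3" using pos by simp
  qed
  have FJ: "0 \<le> F1 * \<J>" using pos J by simp
  have F1J: "F1 * \<J> \<le> 8 * Q" "L * (F1 * \<J>) \<le> 4 * Q" "L\<^sup>2 * (F1 * \<J>) \<le> 2 * Q"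
    using mult_right_mono[OF L23(1) FJ] mult_right_mono[OF L23(2) FJ] mult_right_mono[OF L23(3) FJ]
    by (simp_all add: Q_def mult_ac)
  have \<alpha>: "\<alpha> \<le> \<gamma>"
  proof -
    have "\<kappa>2 / \<kappa>1 = 2 * c2 * K^3" using pos F1p by (simp add: \<kappa> field_simps)
    then have "\<alpha> = R * (2 * c2 * K^3)" by (simp add: \<alpha>_def flip: times_divide_eq_right)
    also have "\<dots> \<le> (K * A * F1) * (2 * c2 * K^3)"
      using R pos by (intro mult_right_mono) auto
    also have "\<dots> = (A * F1 * (2 * c2 * K^4)) * 1" by (simp add: power4_eq_xxxx power3_eq_cube)
    also have "\<dots> \<le> (A * F1 * (2 * c2 * K^4)) * (2 * L)"
      using pos by (intro mult_left_mono) auto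
    also have "\<dots> = A * F1 * L * (4 * c2 * K^4)" by simp
    also have "\<dots> \<le> \<gamma>" unfolding \<gamma>_def C3_def using pos by (intro mult_left_mono) auto
    finally show ?thesis .
  qed
  have \<beta>: "\<beta> \<le> F1 * \<gamma>"
  proof -
    have "\<beta> = 4 * K^3 * F1\<^sup>2 * (F1 / F2)"
      using pos F1p by (simp add: \<beta>_def \<kappa> power2_eq_square power3_eq_cube)
    also have "F1 / F2 \<le> C1 * A * L"
      using F1 pos by (simp add: pos_divide_le_eq mult_ac)
    then have "4 * K^3 * F1\<^sup>2 * (F1 / F2) \<le> 4 * K^3 * F1\<^sup>2 * (C1 * A * L)"
      using pos by (intro mult_left_mono) auto
    also have "\<dots> = F1 * (A * F1 * L * (4 * K^3 * C1))" by (simp add: power2_eq_square)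
    also have "\<dots> \<le> F1 * \<gamma>" unfolding \<gamma>_def C3_def using pos by (intro mult_left_mono) auto
    finally show ?thesis .
  qed
  have \<alpha>\<beta>0: "0 \<le> \<alpha>" "0 \<le> \<beta>" using pos \<kappa>p by (auto simp: \<alpha>_def \<beta>_def)
  have harm: "(\<Sum>h=1..<k. 1 / real h) \<le> H" if "k \<le> N" for k
  proof -
    have "(\<Sum>h=1..<k. 1 / real h) \<le> (\<Sum>h=1..k. 1 / real h)" by (intro sum_mono2) auto
    then show ?thesis using sum_inverse_le_ln[OF that Np(2)] N(2) by (simp add: H_def)
  qed
  have harm': "(\<Sum>h=1..N. 1 / real h) \<le> H"
    using sum_inverse_le_ln[OF order.refl Np(2)] N(2) by (simp add: H_def)
  \<comment> \<open>The end terms have size \<open>z\<close>. Applying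
    \<open>F1 \<le> C1 * A * F2 * L\<close> to one factor of \<open>F1^2\<close> and
    \<open>F1 * L \<le> z\<close> to what remains gives \<open>z \<le> C1 * A * P\<close>.\<close>
  have t1: "4 * z * M \<le> A * (4 * C1 * P)"
  proof -
    have "F1\<^sup>2 \<le> F1 * (C1 * A * F2 * L)"
      unfolding power2_eq_square using F1 F1p by (intro mult_left_mono) auto
    also have "\<dots> = C1 * A * F2 * (F1 * L)" by simp
    also have "\<dots> \<le> C1 * A * F2 * z" using F1 pos by (intro mult_left_mono) auto
    finally have "z * F1\<^sup>2 \<le> z * (C1 * A * F2 * z)" using zp by (intro mult_left_mono) auto
    then have "z \<le> C1 * A * P"
      using F1p by (simp add: P_def field_simps power2_eq_square)
    moreover have "4 * z * M \<le> 4 * z * 1" using M zp by (intro mult_left_mono) auto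
    ultimately show ?thesis by (simp add: mult_ac)
  qed
  have \<kappa>2z: "\<kappa>2 * F1 * z\<^sup>2 = c2 * P"
    using F1p by (simp add: \<kappa> P_def field_simps power2_eq_square power3_eq_cube)
  have t2: "M * ((z + 1) * \<kappa>2 * R) \<le> A * (2 * c2 * K * P)"
  proof -
    have "M * ((z + 1) * \<kappa>2 * R) \<le> 1 * ((2 * z) * \<kappa>2 * (K * A * F1))"
      using M pos \<kappa>p R by (intro mult_mono) auto
    also have "\<dots> = (2 * K * A) * (\<kappa>2 * F1 * z)" by simp
    also have "\<dots> \<le> (2 * K * A) * (\<kappa>2 * F1 * z\<^sup>2)"
      using pos \<kappa>p by (intro mult_left_mono) (auto simp: power2_eq_square)
    also have "\<dots> = A * (2 * c2 * K * P)" unfolding \<kappa>2z by simp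
    finally show ?thesis .
  qed
  have t3: "4 * (\<Sum>h=1..<N. min (1 / F1) (1 / real h) * (\<alpha> + \<beta> / real h)) * \<J> \<le> A * (16 * C3 * C2 * Q)"
  proof -
    have "(\<Sum>h=1..<N. min (1 / F1) (1 / real h) * (\<alpha> + \<beta> / real h)) \<le> (\<Sum>h=1..<N. 2 * \<gamma> * (1 / real h))"
    proof (rule sum_mono)
      fix h assume h: "h \<in> {1..<N}"
      \<comment> \<open>Each summand uses a different side of the minimum: \<alpha> needs the decay
        \<open>1 / h\<close>, while \<open>\<beta> / h\<close> already decays and needs
        \<open>1 / F1\<close> to cancel the excess factor \<open>F1\<close>.\<close>
      have "min (1 / F1) (1 / real h) * \<alpha> \<le> (1 / real h) * \<gamma>"
        using \<alpha> \<alpha>\<beta>0 F1p by (intro mult_mono) auto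
      moreover have "min (1 / F1) (1 / real h) * (\<beta> / real h) \<le> (1 / F1) * (F1 * \<gamma> / real h)"
        using \<beta> \<alpha>\<beta>0 F1p by (intro mult_mono divide_right_mono) auto
      ultimately show "min (1 / F1) (1 / real h) * (\<alpha> + \<beta> / real h) \<le> 2 * \<gamma> * (1 / real h)"
        using F1p by (simp add: distrib_left)
    qed
    also have "\<dots> = 2 * \<gamma> * (\<Sum>h=1..<N. 1 / real h)" by (simp add: sum_distrib_left)
    also have "\<dots> \<le> 2 * \<gamma> * H" using harm[of N] \<gamma> by (intro mult_left_mono) auto
    finally have "4 * (\<Sum>h=1..<N. min (1 / F1) (1 / real h) * (\<alpha> + \<beta> / real h)) * \<J> \<le> 4 * (2 * \<gamma> * H) * \<J>"
      using J by (intro mult_right_mono mult_left_mono) auto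
    also have "\<dots> = 8 * A * C3 * C2 * (L\<^sup>2 * (F1 * \<J>))" by (simp add: \<gamma>_def H_def power2_eq_square)
    also have "\<dots> \<le> 8 * A * C3 * C2 * (2 * Q)" using F1J pos C3 by (intro mult_left_mono) auto
    finally show ?thesis by simp
  qed
  have V: "V k \<le> (2 * z * K * A * F1 + 4 * H * (F1 * \<gamma> * H)) * (1 / real k) + 4 * H * \<gamma>" if k: "1 \<le> k" "k \<le> N" for k
  proof -
    have "(\<Sum>h=1..<k. (\<alpha> + \<beta> / real h) * (2 * ln (2 * z + 3))) \<le> (\<Sum>h=1..<k. (\<gamma> + F1 * \<gamma> * (1 / real h)) * (2 * H))"
      using \<alpha> \<beta> \<alpha>\<beta>0 \<gamma> F1p N(3) zp
      by (intro sum_mono mult_mono add_mono) (auto simp: H_def divide_right_mono)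
    also have "\<dots> = 2 * H * (real (k - 1) * \<gamma> + F1 * \<gamma> * (\<Sum>h=1..<k. 1 / real h))"
      by (simp add: sum_distrib_left sum.distrib algebra_simps)
    also have "\<dots> \<le> 2 * H * (real k * \<gamma> + F1 * \<gamma> * H)"
      using harm[OF k(2)] H \<gamma> F1p by (intro mult_left_mono add_mono mult_right_mono) auto
    finally have "R * (z + 1) + 2 * (\<Sum>h=1..<k. (\<alpha> + \<beta> / real h) * (2 * ln (2 * z + 3))) \<le>
        (K * A * F1) * (2 * z) + 2 * (2 * H * (real k * \<gamma> + F1 * \<gamma> * H))"
      using R pos by (intro add_mono mult_mono mult_left_mono) auto
    then have "V k \<le> ((K * A * F1) * (2 * z) + 2 * (2 * H * (real k * \<gamma> + F1 * \<gamma> * H))) / real k"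
      unfolding V_def by (intro divide_right_mono) auto
    also have "\<dots> = (2 * z * K * A * F1 + 4 * H * (F1 * \<gamma> * H)) * (1 / real k) + 4 * H * \<gamma>"
      using k by (simp add: field_simps)
    finally show ?thesis .
  qed
  have HgJ: "H * \<gamma> * \<J> \<le> A * (C2 * C3 * (2 * Q))"
  proof -
    have "H * \<gamma> * \<J> = (A * C2 * C3) * (L\<^sup>2 * (F1 * \<J>))" by (simp add: \<gamma>_def H_def power2_eq_square)
    also have "\<dots> \<le> (A * C2 * C3) * (2 * Q)" using F1J pos C3 by (intro mult_left_mono) auto
    finally show ?thesis by (simp add: mult_ac)
  qed
  have t4: "M / z * (8 * V N1) \<le> A * (768 * K * c2 * P + 8 * (16 * K + 4 * C2 * C3 * (2 + 3 * C2)) * Q)"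
  proof -
    have \<delta>P: "F1 * \<delta>' \<le> 4 * c2 * P"
    proof -
      have "(z + 1)\<^sup>2 \<le> (2 * z)\<^sup>2" using pos by (intro power_mono) auto
      then have "F1 * (\<kappa>2 * (z + 1)\<^sup>2) \<le> F1 * (\<kappa>2 * (2 * z)\<^sup>2)"
        using F1p \<kappa>p by (intro mult_left_mono) auto
      also have "\<dots> = 4 * (\<kappa>2 * F1 * z\<^sup>2)" by (simp add: power2_eq_square)
      finally show ?thesis unfolding \<kappa>2z \<delta>'_def by simp
    qed
    have FN: "F1 / real N1 \<le> 12 * (F1 * \<delta>') + F1 / real N"
      using mult_left_mono[OF N1(3), of F1] F1p by (simp add: \<delta>'_def distrib_left)
    have FNz: "F1 / real N \<le> F1 / z" using N zp F1p by (intro divide_left_mono) auto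
    have "F1 / z \<le> 1" using F1 zp by simp
    \<comment> \<open>The tangent part is at most 2, since
      \<open>6 * \<delta>' * F1 \<le> 1\<close>, and the truncation part at most 1.\<close>
    then have FN3: "F1 / real N1 \<le> 3" using FN FNz \<delta> by (simp add: \<delta>'_def mult_ac)
    have \<delta>'0: "0 \<le> F1 * \<delta>'" using F1p \<kappa>p by (simp add: \<delta>'_def)
    \<comment> \<open>The two parts of \<open>1 / N1\<close> are treated differently: the tangent
      part has the size of \<open>P\<close> and uses \<open>M \<le> 1\<close>, the truncation part
      \<open>F1 / z\<close> uses \<open>M / z \<le> \<J>\<close>.\<close>
    have a1: "M * (F1 / real N1) \<le> 48 * c2 * P + 8 * Q"
    proof -
      have "M * (F1 / real N1) \<le> M * (12 * (F1 * \<delta>') + F1 / z)"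
        using FN FNz M by (intro mult_left_mono) auto
      also have "\<dots> = M * (12 * (F1 * \<delta>')) + F1 * (M / z)" by (simp add: distrib_left)
      also have "\<dots> \<le> 1 * (12 * (F1 * \<delta>')) + F1 * \<J>"
        using M Mz F1p \<delta>'0 by (intro add_mono mult_right_mono mult_left_mono) auto
      finally show ?thesis using \<delta>P F1J by simp
    qed
    have a2: "\<J> * (4 * H * \<gamma> * (1 + H * (F1 / real N1))) \<le> A * (4 * C2 * C3 * (2 + 3 * C2) * Q)"
    proof -
      have "\<J> * (4 * H * \<gamma> * (1 + H * (F1 / real N1))) \<le> \<J> * (4 * H * \<gamma> * (1 + H * 3))"
        using FN3 H \<gamma> J by (intro mult_left_mono add_left_mono) auto
      also have "\<dots> = 4 * (H * \<gamma> * \<J>) + 12 * (A * C2\<^sup>2 * C3) * (F1 * L^3 * \<J>)"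
        by (simp add: H_def \<gamma>_def algebra_simps power2_eq_square power3_eq_cube)
      also have "\<dots> \<le> 4 * (A * (C2 * C3 * (2 * Q))) + 12 * (A * C2\<^sup>2 * C3) * Q"
        unfolding Q_def[symmetric] using pos C3 by (intro add_mono mult_left_mono HgJ) auto
      also have "\<dots> = A * (4 * C2 * C3 * (2 + 3 * C2) * Q)"
        by (simp add: algebra_simps power2_eq_square)
      finally show ?thesis .
    qed
    have "M / z * V N1 \<le> M / z * ((2 * z * K * A * F1 + 4 * H * (F1 * \<gamma> * H)) * (1 / real N1) + 4 * H * \<gamma>)"
      using V[of N1] N1 Mz by (intro mult_left_mono) auto
    also have "\<dots> = 2 * K * A * (M * (F1 / real N1)) + M / z * (4 * H * \<gamma> * (1 + H * (F1 / real N1)))"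
      using zp N1(1) by (simp add: field_simps)
    also have "\<dots> \<le> 2 * K * A * (48 * c2 * P + 8 * Q) + \<J> * (4 * H * \<gamma> * (1 + H * (F1 / real N1)))"
      using a1 Mz pos H \<gamma> by (intro add_mono mult_left_mono mult_right_mono) auto
    also have "\<dots> \<le> 2 * K * A * (48 * c2 * P + 8 * Q) + A * (4 * C2 * C3 * (2 + 3 * C2) * Q)"
      using a2 by simp
    finally have "8 * (M / z * V N1) \<le> 8 * (2 * K * A * (48 * c2 * P + 8 * Q) + A * (4 * C2 * C3 * (2 + 3 * C2) * Q))"
      by simp
    also have "\<dots> = A * (768 * K * c2 * P + 8 * (16 * K + 4 * C2 * C3 * (2 + 3 * C2)) * Q)"
      by (simp add: algebra_simps)
    finally show ?thesis by (simp only: mult.left_commute[of "M / z" 8])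
  qed
  have t5: "M / z * ((\<Sum>k=1..N. V k) / real N) \<le> A * ((8 * K * C2 + 4 * C2^3 * C3 + 8 * C2 * C3) * Q)"
  proof -
    define E where "E = 2 * z * K * A * F1 + 4 * H * (F1 * \<gamma> * H)"
    have E: "0 \<le> E" using pos H \<gamma> by (simp add: E_def)
    have "(\<Sum>k=1..N. V k) \<le> (\<Sum>k=1..N. E * (1 / real k) + 4 * H * \<gamma>)"
      unfolding E_def by (intro sum_mono V) auto
    also have "\<dots> = E * (\<Sum>k=1..N. 1 / real k) + real N * (4 * H * \<gamma>)"
      by (simp add: sum.distrib sum_distrib_left)
    also have "\<dots> \<le> E * H + real N * (4 * H * \<gamma>)"
      using harm' E by (intro add_right_mono mult_left_mono)
    finally have "(\<Sum>k=1..N. V k) / real N \<le> (E * H + real N * (4 * H * \<gamma>)) / real N"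
      by (intro divide_right_mono) auto
    \<comment> \<open>The grouping isolates \<open>z / N\<close> and \<open>F1 * L / N\<close>, both
      at most 1 because \<open>F1 * L \<le> z \<le> N\<close>. The second one absorbs a logarithm,
      so that only \<open>L^3\<close> remains after multiplication by \<open>F1\<close>.\<close>
    also have "\<dots> = (z / real N) * (2 * K * A * F1 * H) + (F1 * L / real N) * (4 * C2^3 * L\<^sup>2 * \<gamma>) + 4 * H * \<gamma>"
      using Np by (simp add: E_def H_def field_simps power2_eq_square power3_eq_cube)
    also have "\<dots> \<le> 1 * (2 * K * A * F1 * H) + 1 * (4 * C2^3 * L\<^sup>2 * \<gamma>) + 4 * H * \<gamma>"
      using pos H \<gamma> N F1 Np by (intro add_mono mult_right_mono) auto
    finally have "M / z * ((\<Sum>k=1..N. V k) / real N) \<le> \<J> * (1 * (2 * K * A * F1 * H) + 1 * (4 * C2^3 * L\<^sup>2 * \<gamma>) + 4 * H * \<gamma>)"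
      using Mz pos H \<gamma> by (intro mult_mono[OF Mz(1)] ) (auto simp: V_def \<alpha>\<beta>0 intro!: sum_nonneg divide_nonneg_nonneg add_nonneg_nonneg mult_nonneg_nonneg)
    also have "\<dots> = 2 * K * A * C2 * (L * (F1 * \<J>)) + 4 * C2^3 * C3 * A * (F1 * L^3 * \<J>) + 4 * (H * \<gamma> * \<J>)"
      by (simp add: H_def \<gamma>_def algebra_simps power2_eq_square power3_eq_cube)
    also have "\<dots> \<le> 2 * K * A * C2 * (4 * Q) + 4 * C2^3 * C3 * A * Q + 4 * (A * (C2 * C3 * (2 * Q)))"
      unfolding Q_def[symmetric] using HgJ F1J pos C3 by (intro add_mono mult_left_mono) auto
    also have "\<dots> = A * ((8 * K * C2 + 4 * C2^3 * C3 + 8 * C2 * C3) * Q)"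
      by (simp add: algebra_simps)
    finally show ?thesis .
  qed
  have "M / z * (8 * V N1 + 24 * ((\<Sum>k=1..N. V k) / real N)) =
      M / z * (8 * V N1) + 24 * (M / z * ((\<Sum>k=1..N. V k) / real N))"
    by (simp add: distrib_left)
  also have "\<dots> \<le> A * (768 * K * c2 * P + 8 * (16 * K + 4 * C2 * C3 * (2 + 3 * C2)) * Q)
      + 24 * (A * ((8 * K * C2 + 4 * C2^3 * C3 + 8 * C2 * C3) * Q))"
    using t4 t5 by simp
  finally show ?thesis
    unfolding P_def[symmetric] Q_def[symmetric] using t1 t2 t3 by (simp add: algebra_simps)
qed

section \<open>Functions with doubling second derivative\<close>

locale doubling_function =
  fixes f f' f'' :: "real \<Rightarrow> real" and c2 A0 :: real
  assumes f_deriv: "\<And>x. x > 0 \<Longrightarrow> (f has_real_derivative f' x) (at x)"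
      and f'_deriv: "\<And>x. x > 0 \<Longrightarrow> (f' has_real_derivative f'' x) (at x)"
      and f_pos: "\<And>x. x > 0 \<Longrightarrow> f x > 0"
      and f'_pos: "\<And>x. x > 0 \<Longrightarrow> f' x > 0"
      and f''_pos: "\<And>x. x > 0 \<Longrightarrow> f'' x > 0"
      and f''_lower: "\<And>x y. 0 < x \<Longrightarrow> x \<le> y \<Longrightarrow> y \<le> 2 * x \<Longrightarrow> f'' x \<le> 2 * f'' y"
      and f''_upper: "\<And>x y. 0 < x \<Longrightarrow> x \<le> y \<Longrightarrow> y \<le> 2 * x \<Longrightarrow> f'' y \<le> c2 * f'' x"
      and A0: "A0 \<ge> 2" "f' A0 \<ge> 1"
begin

lemma c2_ge_1: "1 \<le> c2"
  using f''_upper[of 1 1] f''_pos[of 1] by simp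

lemma f'_mean_value: "0 < x \<Longrightarrow> x < y \<Longrightarrow> \<exists>t. x < t \<and> t < y \<and> f' y - f' x = (y - x) * f'' t"
  using MVT2[of x y f' f''] f'_deriv by auto

lemma f_mean_value: "0 < x \<Longrightarrow> x < y \<Longrightarrow> \<exists>t. x < t \<and> t < y \<and> f y - f x = (y - x) * f' t"
  using MVT2[of x y f f'] f_deriv by auto

lemma f'_mono: "0 < x \<Longrightarrow> x \<le> y \<Longrightarrow> f' x \<le> f' y"
proof (cases "x = y")
  case False
  assume "0 < x" "x \<le> y"
  then obtain t where "x < t" "t < y" "f' y - f' x = (y - x) * f'' t"
    using f'_mean_value[of x y] False by auto
  moreover have "0 < f'' t" using \<open>0 < x\<close> \<open>x < t\<close> by (intro f''_pos) auto
  ultimately show ?thesis by (smt (verit) mult_pos_pos)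
qed simp

lemma f'_ge_1: "A0 \<le> x \<Longrightarrow> 1 \<le> f' x"
  using f'_mono[of A0 x] A0 by simp

lemma f_strict_mono: "0 < x \<Longrightarrow> x < y \<Longrightarrow> f x < f y"
proof -
  assume "0 < x" "x < y"
  then obtain t where "x < t" "t < y" "f y - f x = (y - x) * f' t"
    using f_mean_value[of x y] by auto
  moreover have "0 < f' t" using \<open>0 < x\<close> \<open>x < t\<close> by (intro f'_pos) auto
  ultimately show ?thesis by (smt (verit) mult_pos_pos)
qed

lemma f_less_iff: "0 < x \<Longrightarrow> 0 < y \<Longrightarrow> f x < f y \<longleftrightarrow> x < y"
  using f_strict_mono[of x y] f_strict_mono[of y x] by (cases x y rule: linorder_cases) auto

lemma f_le_iff: "0 < x \<Longrightarrow> 0 < y \<Longrightarrow> f x \<le> f y \<longleftrightarrow> x \<le> y"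
  using f_less_iff[of y x] by (auto simp: not_less[symmetric])

lemma f_diff_ge: "0 < x \<Longrightarrow> x \<le> y \<Longrightarrow> (y - x) * f' x \<le> f y - f x"
proof (cases "x = y")
  case False
  assume "0 < x" "x \<le> y"
  then obtain t where t: "x < t" "t < y" "f y - f x = (y - x) * f' t"
    using f_mean_value[of x y] False by auto
  with \<open>0 < x\<close> show ?thesis using f'_mono[of x t] by (auto intro!: mult_left_mono)
qed simp

lemma f_diff_le: "0 < x \<Longrightarrow> x \<le> y \<Longrightarrow> f y - f x \<le> (y - x) * f' y"
proof (cases "x = y")
  case False
  assume "0 < x" "x \<le> y"
  then obtain t where t: "x < t" "t < y" "f y - f x = (y - x) * f' t"
    using f_mean_value[of x y] False by auto
  with \<open>0 < x\<close> show ?thesis using f'_mono[of t y] by (auto intro!: mult_left_mono)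
qed simp

text \<open>The increment of \<open>f'\<close> over \<open>[x / 2, x]\<close> is at most
  \<open>f' x\<close>, and by the upper doubling bound \<open>f'' x\<close> is at most
  \<open>c2\<close> times any value of \<open>f''\<close> there.\<close>

lemma f''_le_f': 
  assumes "0 < x"
  shows "x * f'' x \<le> 2 * c2 * f' x"
proof -
  obtain t where t: "x / 2 < t" "t < x" "f' x - f' (x / 2) = (x - x / 2) * f'' t"
    using f'_mean_value[of "x / 2" x] assms by auto
  have "f'' x \<le> c2 * f'' t" using t assms by (intro f''_upper) auto
  then have "x * f'' x \<le> x * (c2 * f'' t)" using assms by (intro mult_left_mono) auto
  also have "\<dots> = 2 * c2 * (f' x - f' (x / 2))" using t by simp
  also have "\<dots> \<le> 2 * c2 * f' x"
    using f'_pos[of "x / 2"] assms c2_ge_1 by (intro mult_left_mono) auto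
  finally show ?thesis .
qed

text \<open>Doubling constant of \<open>f'\<close>: passing from \<open>x\<close> to
  \<open>2 * x\<close> adds at most \<open>c2 * (x * f'' x)\<close>, and
  \<open>x * f'' x \<le> 2 * c2 * f' x\<close>.\<close>

definition growth :: real where "growth = 1 + 2 * c2\<^sup>2"

lemma growth_ge_1: "1 \<le> growth"
  by (simp add: growth_def)

lemma f'_le_growth:
  assumes "0 < x" "x \<le> t" "t \<le> 2 * x"
  shows "f' t \<le> growth * f' x"
proof -
  obtain s where s: "x < s" "s < 2 * x" "f' (2 * x) - f' x = (2 * x - x) * f'' s"
    using f'_mean_value[of x "2 * x"] assms by auto
  have "f' t \<le> f' (2 * x)" using assms by (intro f'_mono) auto
  also have "\<dots> = f' x + x * f'' s" using s by simp
  also have "x * f'' s \<le> x * (c2 * f'' x)"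
    using s assms by (intro mult_left_mono f''_upper) auto
  also have "\<dots> = c2 * (x * f'' x)" by simp
  also have "\<dots> \<le> c2 * (2 * c2 * f' x)"
    using f''_le_f'[OF assms(1)] c2_ge_1 by (intro mult_left_mono) auto
  finally show ?thesis by (simp add: growth_def algebra_simps power2_eq_square)
qed

section \<open>Dyadic propagation from the interval between A0 and 2 A0\<close>

lemma dyadic_decomposition:
  assumes "A0 \<le> x"
  shows "\<exists>k y. A0 \<le> y \<and> y \<le> 2 * A0 \<and> x = 2 ^ k * y \<and> real k \<le> 2 * ln x"
proof -
  define r where "r = log 2 (x / A0)"
  define k where "k = nat \<lfloor>r\<rfloor>"
  have x: "1 \<le> x / A0" "0 < A0" using assms A0 by auto
  have r: "0 \<le> r" unfolding r_def using x by (subst zero_le_log_cancel_iff) auto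
  have k: "real k \<le> r" "r < real k + 1" using r unfolding k_def by linarith+
  have xr: "x / A0 = 2 powr r" unfolding r_def using x assms by (subst powr_log_cancel) auto
  have "2 powr real k \<le> 2 powr r" "2 powr r \<le> 2 powr (real k + 1)"
    using k by (intro powr_mono; simp)+
  then have "2 ^ k \<le> x / A0" "x / A0 \<le> 2 * 2 ^ k"
    unfolding xr by (simp_all add: powr_add powr_realpow)
  then have "A0 \<le> x / 2 ^ k" "x / 2 ^ k \<le> 2 * A0"
    using x by (auto simp: field_simps)
  moreover have "real k \<le> 2 * ln x"
  proof -
    have "real k \<le> log 2 x"
    proof -
      have "r = log 2 x - log 2 A0" unfolding r_def using x assms by (subst log_divide) auto
      moreover have "0 \<le> log 2 A0" using A0 by (subst zero_le_log_cancel_iff) auto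
      ultimately show ?thesis using k by simp
    qed
    also have "\<dots> = ln x / ln 2" by (simp add: log_def)
    also have "\<dots> \<le> ln x / (1/2)"
    proof (rule divide_left_mono)
      show "1/2 \<le> ln (2::real)" using ln2_ge_two_thirds by simp
      show "0 \<le> ln x" using assms A0 by auto
    qed auto
    finally show ?thesis by simp
  qed
  ultimately show ?thesis by (intro exI[of _ k] exI[of _ "x / 2 ^ k"]) auto
qed

lemma ln_ge_half: "A0 \<le> x \<Longrightarrow> 1/2 \<le> ln x"
  using ln2_ge_two_thirds A0 ln_mono[of 2 x] by linarith

definition f''_low :: real where "f''_low = A0 * f'' A0 / 2"

lemma f''_low_pos: "0 < f''_low"
  using f''_pos[of A0] A0 by (simp add: f''_low_def)

lemma f''_low_base:
  assumes "A0 \<le> y" "y \<le> 2 * A0"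
  shows "f''_low \<le> y * f'' y"
proof -
  have "A0 * (f'' A0 / 2) \<le> y * f'' y"
    using f''_lower[of A0 y] f''_pos[of A0] assms A0 by (intro mult_mono) auto
  then show ?thesis by (simp add: f''_low_def)
qed

text \<open>Doubling the argument exactly compensates the permitted halving of
  \<open>f''\<close>.\<close>

lemma f''_double: "0 < w \<Longrightarrow> w * f'' w \<le> (2 * w) * f'' (2 * w)"
  using f''_lower[of w "2 * w"] by (auto simp: mult_left_mono)

lemma f''_low_le:
  assumes "A0 \<le> x"
  shows "f''_low \<le> x * f'' x"
proof -
  obtain k y where y: "A0 \<le> y" "y \<le> 2 * A0" and x: "x = 2 ^ k * y"
    using dyadic_decomposition[OF assms] by auto
  have "f''_low \<le> (2 ^ k * y) * f'' (2 ^ k * y)"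
  proof (induction k)
    case 0
    then show ?case using f''_low_base[OF y] by simp
  next
    case (Suc k)
    have "0 < 2 ^ k * y" using y A0 by simp
    from f''_double[OF this] Suc show ?case by (simp add: mult_ac)
  qed
  then show ?thesis by (simp add: x)
qed

text \<open>If \<open>D\<close> is the quotient inside, \<open>f' x\<close> is at most
  \<open>D + k\<close> times \<open>x * f'' x\<close> after \<open>k\<close> doublings; both
  \<open>D\<close> and \<open>k\<close> are then measured against \<open>ln x\<close>, using
  \<open>1 \<le> 2 * ln x\<close> and \<open>k \<le> 2 * ln x\<close>.\<close>

definition deriv_ratio :: real where "deriv_ratio = 2 * (f' (2 * A0) / f''_low) + 2"

lemma deriv_ratio_nonneg: "0 \<le> deriv_ratio"
  using f''_low_pos f'_pos[of "2 * A0"] A0 by (simp add: deriv_ratio_def)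

text \<open>The lower doubling constant \<open>1/2\<close> makes \<open>x f''(x)\<close> essentially nondecreasing, so the dyadic
  blocks contribute at most \<open>O(x f''(x))\<close> each to \<open>f'(x)\<close>.\<close>

lemma f'_le_f'':
  assumes "A0 \<le> x"
  shows "f' x \<le> deriv_ratio * x * f'' x * ln x"
proof -
  obtain k y where y: "A0 \<le> y" "y \<le> 2 * A0" and x: "x = 2 ^ k * y" and k: "real k \<le> 2 * ln x"
    using dyadic_decomposition[OF assms] by auto
  define D where "D = f' (2 * A0) / f''_low"
  have D: "0 \<le> D" using f''_low_pos f'_pos[of "2 * A0"] A0 by (simp add: D_def)
  have "f' (2 ^ k * y) \<le> (D + real k) * ((2 ^ k * y) * f'' (2 ^ k * y))"
  proof (induction k)
    case 0
    have "f' y \<le> f' (2 * A0)" using y A0 by (intro f'_mono) auto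
    also have "\<dots> = D * f''_low" using f''_low_pos by (simp add: D_def)
    also have "\<dots> \<le> D * (y * f'' y)" using f''_low_base[OF y] D by (intro mult_left_mono) auto
    finally show ?case by simp
  next
    case (Suc k)
    define w where "w = 2 ^ k * y"
    have w: "0 < w" using y A0 by (simp add: w_def)
    obtain s where s: "w < s" "s < 2 * w" "f' (2 * w) - f' w = (2 * w - w) * f'' s"
      using f'_mean_value[of w "2 * w"] w by auto
    have "f' (2 * w) = f' w + w * f'' s" using s by simp
    also have "w * f'' s \<le> w * (2 * f'' (2 * w))"
      using s w by (intro mult_left_mono f''_lower) auto
    also have "f' w \<le> (D + real k) * (w * f'' w)" using Suc by (simp add: w_def)
    also have "\<dots> \<le> (D + real k) * ((2 * w) * f'' (2 * w))"
      using f''_double[OF w] D by (intro mult_left_mono) auto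
    finally have "f' (2 * w) \<le> (D + real (Suc k)) * ((2 * w) * f'' (2 * w))"
      by (simp add: algebra_simps)
    then show ?case by (simp add: w_def mult_ac)
  qed
  then have "f' x \<le> (D + real k) * (x * f'' x)" by (simp add: x)
  also have "\<dots> \<le> (deriv_ratio * ln x) * (x * f'' x)"
  proof (rule mult_right_mono)
    have "D * 1 \<le> D * (2 * ln x)" using ln_ge_half[OF assms] D by (intro mult_left_mono) auto
    then show "D + real k \<le> deriv_ratio * ln x"
      using k by (simp add: deriv_ratio_def D_def algebra_simps)
    show "0 \<le> x * f'' x" using f''_low_le[OF assms] f''_low_pos by simp
  qed
  finally show ?thesis by (simp add: mult_ac)
qed

definition log_growth :: real where "log_growth = 2 * ln growth + 2 * ln (f' (2 * A0))"

lemma log_growth_nonneg: "0 \<le> log_growth"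
  using growth_ge_1 f'_ge_1[of "2 * A0"] A0 by (simp add: log_growth_def)

text \<open>Polynomial growth of \<open>f'\<close>. It makes \<open>ln z\<close> comparable with
  \<open>ln A\<close> in the main range, so that logarithms of \<open>z\<close> and \<open>N\<close>
  count as powers of \<open>ln A\<close>.\<close>

lemma ln_f'_le:
  assumes "A0 \<le> x"
  shows "ln (f' x) \<le> log_growth * ln x"
proof -
  obtain k y where y: "A0 \<le> y" "y \<le> 2 * A0" and x: "x = 2 ^ k * y" and k: "real k \<le> 2 * ln x"
    using dyadic_decomposition[OF assms] by auto
  have "f' (2 ^ k * y) \<le> growth ^ k * f' (2 * A0)"
  proof (induction k)
    case 0
    then show ?case using y A0 f'_mono[of y "2 * A0"] by simp
  next
    case (Suc k)
    have "f' (2 * (2 ^ k * y)) \<le> growth * f' (2 ^ k * y)"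
      using y A0 by (intro f'_le_growth) auto
    also have "\<dots> \<le> growth * (growth ^ k * f' (2 * A0))"
      using Suc growth_ge_1 by (intro mult_left_mono) auto
    finally show ?case by (simp add: mult_ac)
  qed
  then have "ln (f' x) \<le> ln (growth ^ k * f' (2 * A0))"
    using f'_pos[of x] assms A0 by (intro ln_mono) (auto simp: x)
  also have "\<dots> = real k * ln growth + ln (f' (2 * A0))"
    using growth_ge_1 f'_pos[of "2 * A0"] A0 by (subst ln_mult) (auto simp: ln_realpow)
  also have "\<dots> \<le> (2 * ln x) * ln growth + ln (f' (2 * A0)) * (2 * ln x)"
  proof (intro add_mono mult_right_mono k)
    show "0 \<le> ln growth" using growth_ge_1 by simp
    have "ln (f' (2 * A0)) * 1 \<le> ln (f' (2 * A0)) * (2 * ln x)"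
      using ln_ge_half[OF assms] f'_ge_1[of "2 * A0"] A0 by (intro mult_left_mono) auto
    then show "ln (f' (2 * A0)) \<le> ln (f' (2 * A0)) * (2 * ln x)" by simp
  qed
  finally show ?thesis by (simp add: log_growth_def algebra_simps)
qed

section \<open>The inverse function and its first two derivatives\<close>

abbreviation g :: "real \<Rightarrow> real" where "g \<equiv> inv_into {0<..} f"

lemma g_f [simp]: "0 < t \<Longrightarrow> g (f t) = t"
proof (rule inv_into_f_f)
  show "inj_on f {0<..}"
  proof (rule linorder_inj_onI)
    show "f x \<noteq> f y" if "x < y" "x \<in> {0<..}" for x y
      using f_strict_mono[of x y] that by simp
  qed auto
qed simp

lemma isCont_f: "0 < t \<Longrightarrow> isCont f t"
  using f_deriv DERIV_isCont by blast

text \<open>\<open>inv_into\<close> is meaningful only on the range of \<open>f\<close>; the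
  intermediate value theorem places \<open>u\<close> there and locates its preimage.\<close>

lemma g_range:
  assumes "0 < s" "s \<le> t" "f s \<le> u" "u \<le> f t"
  shows "f (g u) = u" "s \<le> g u" "g u \<le> t"
proof -
  have "\<exists>x. s \<le> x \<and> x \<le> t \<and> f x = u"
    using assms isCont_f by (intro IVT) auto
  then obtain x where x: "s \<le> x" "x \<le> t" "f x = u" by auto
  moreover have "0 < x" using x assms by simp
  ultimately have "g u = x" using g_f[of x] by simp
  with x show "f (g u) = u" "s \<le> g u" "g u \<le> t" by auto
qed

lemma g_deriv:
  assumes "0 < t"
  shows "(g has_real_derivative 1 / f' t) (at (f t))"
proof -
  have "(g has_real_derivative inverse (f' t)) (at (f t))"
  proof (rule DERIV_inverse_function[where a="f (t / 2)" and b="f (2 * t)"])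
    show "(f has_real_derivative f' t) (at (g (f t)))" using assms f_deriv by simp
    show "f' t \<noteq> 0" using f'_pos[OF assms] by simp
    show "f (t / 2) < f t" "f t < f (2 * t)" using assms by (auto intro!: f_strict_mono)
    show "f (g y) = y" if "f (t / 2) < y" "y < f (2 * t)" for y
      using g_range[of "t / 2" "2 * t" y] that assms by auto
    show "isCont g (f t)"
      by (rule isCont_inverse_function2[where a="t / 2" and b="2 * t"])
         (use assms in \<open>auto intro!: isCont_f g_f\<close>)
  qed
  then show ?thesis by (simp add: inverse_eq_divide)
qed

lemma g_second_deriv:
  assumes "0 < t"
  shows "((\<lambda>u. 1 / f' (g u)) has_real_derivative - (f'' t / (f' t)^3)) (at (f t))"
proof -
  have "((\<lambda>u. f' (g u)) has_real_derivative f'' t * (1 / f' t)) (at (f t))"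
    using DERIV_chain2[of f' "f'' t" g "f t" "1 / f' t" UNIV] g_deriv[OF assms] f'_deriv[OF assms] assms by simp
  then show ?thesis
    using f'_pos[OF assms] assms
    by (auto intro!: derivative_eq_intros simp: power2_eq_square power3_eq_cube)
qed

lemma deriv_g: "0 < t \<Longrightarrow> deriv g (f t) = 1 / f' t"
  using g_deriv by (rule DERIV_imp_deriv)

section \<open>Counting the preimages of an integer under the floor of f\<close>

context
  fixes A :: nat
  assumes A: "A0 \<le> real A"
begin

abbreviation (input) X :: real where "X \<equiv> f (real A)"
abbreviation (input) Y :: real where "Y \<equiv> f (real (2 * A))"

definition hits :: "nat \<Rightarrow> nat set" where
  "hits m = {n \<in> {A<..2 * A}. nat \<lfloor>f (real n)\<rfloor> = m}"

lemma A_pos: "0 < real A" "2 \<le> real A"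
  using A A0 by auto

text \<open>Since \<open>f' \<ge> 1\<close> from \<open>A\<close> on, values at distinct integers
  are at least 1 apart. So no floor is attained twice, and floors for \<open>n > A\<close> exceed
  \<open>f A\<close>.\<close>

lemma f_step:
  assumes "A \<le> n" "n < n'"
  shows "f (real n) + 1 \<le> f (real n')"
proof -
  have "1 * 1 \<le> (real n' - real n) * f' (real n)"
    using assms A f'_ge_1[of "real n"] by (intro mult_mono) auto
  also have "\<dots> \<le> f (real n') - f (real n)"
    using assms A_pos by (intro f_diff_ge) auto
  finally show ?thesis by simp
qed

lemma floor_f_in_range:
  assumes "n \<in> {A<..2 * A}"
  shows "X < real (nat \<lfloor>f (real n)\<rfloor>)" "real (nat \<lfloor>f (real n)\<rfloor>) \<le> Y"
proof -
  have n0: "0 < real n" using assms by auto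
  have eq: "real (nat \<lfloor>f (real n)\<rfloor>) = of_int \<lfloor>f (real n)\<rfloor>"
    using f_pos[OF n0] by simp
  show "X < real (nat \<lfloor>f (real n)\<rfloor>)"
    unfolding eq using f_step[of A n] assms by auto linarith
  have "f (real n) \<le> Y" using assms n0 A_pos by (subst f_le_iff) auto
  then show "real (nat \<lfloor>f (real n)\<rfloor>) \<le> Y"
    unfolding eq by linarith
qed

lemma card_hits_le_1: "card (hits m) \<le> 1"
proof -
  have "n = n'" if "n \<in> hits m" "n' \<in> hits m" for n n'
  proof (rule ccontr)
    have *: "nat \<lfloor>f (real n)\<rfloor> \<noteq> nat \<lfloor>f (real n')\<rfloor>" if "A < n" "n < n'" for n n'
    proof -
      have "0 < f (real n)" using that by (intro f_pos) auto
      then show ?thesis using f_step[of n n'] that by linarith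
    qed
    assume "n \<noteq> n'"
    then show False using that *[of n n'] *[of n' n] by (auto simp: hits_def neq_iff)
  qed
  moreover have "finite (hits m)" by (simp add: hits_def)
  ultimately show ?thesis by (simp add: card_le_Suc0_iff_eq)
qed

text \<open>\<open>n\<close> hits \<open>m\<close> iff \<open>g m \<le> n < g (m + 1)\<close>, a
  half-open interval whose integers are counted by ceilings. The hypothesis
  \<open>m + 1 \<le> Y\<close> prevents truncation at \<open>2 * A\<close>; the last
  \<open>m\<close> may fail it.\<close>

lemma card_hits:
  assumes m: "X < real m" "real m + 1 \<le> Y"
  shows "real (card (hits m)) = of_int \<lceil>g (real m + 1)\<rceil> - of_int \<lceil>g (real m)\<rceil>"
proof -
  have A2: "real A \<le> real (2 * A)" by simp
  note r0 = g_range[OF A_pos(1) A2, of "real m"]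
  note r1 = g_range[OF A_pos(1) A2, of "real m + 1"]
  have gm: "f (g (real m)) = real m" "real A \<le> g (real m)" "g (real m) \<le> real (2 * A)"
    using r0 m by auto
  have gm1: "f (g (real m + 1)) = real m + 1" "real A \<le> g (real m + 1)" "g (real m + 1) \<le> real (2 * A)"
    using r1 m by auto
  have Alt: "real A < g (real m)"
    using f_less_iff[of "real A" "g (real m)"] gm m A_pos by simp
  have lt: "g (real m) < g (real m + 1)"
    using f_less_iff[of "g (real m)" "g (real m + 1)"] gm gm1 A_pos by simp
  have "n \<in> hits m \<longleftrightarrow> n \<in> {nat \<lceil>g (real m)\<rceil>..<nat \<lceil>g (real m + 1)\<rceil>}" for n
  proof (cases "n = 0")
    \<comment> \<open>Monotonicity of \<open>f\<close> is available only for positive arguments, so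
      0 is treated separately; it belongs to neither set.\<close>
    case True
    have "0 < g (real m)" using Alt by linarith
    then have "0 < nat \<lceil>g (real m)\<rceil>" by simp
    with True show ?thesis by (auto simp: hits_def)
  next
    case False
    then have n: "0 < real n" by simp
    have "nat \<lfloor>f (real n)\<rfloor> = m \<longleftrightarrow> real m \<le> f (real n) \<and> f (real n) < real m + 1"
      using f_pos[OF n] by linarith
    also have "\<dots> \<longleftrightarrow> g (real m) \<le> real n \<and> real n < g (real m + 1)"
      using f_le_iff[of "g (real m)" "real n"] f_less_iff[of "real n" "g (real m + 1)"] gm gm1 n A_pos by simp
    finally have 1: "nat \<lfloor>f (real n)\<rfloor> = m \<longleftrightarrow> g (real m) \<le> real n \<and> real n < g (real m + 1)" .
    have 2: "g (real m) \<le> real n \<longleftrightarrow> nat \<lceil>g (real m)\<rceil> \<le> n"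
      using Alt by linarith
    have 3: "real n < g (real m + 1) \<longleftrightarrow> n < nat \<lceil>g (real m + 1)\<rceil>"
      using gm1(2) by linarith
    have 4: "n \<in> {A<..2 * A}" if "g (real m) \<le> real n" "real n < g (real m + 1)"
    proof -
      have "real A < real n" "real n \<le> real (2 * A)"
        using that Alt gm1(3) by linarith+
      then show ?thesis by auto
    qed
    show ?thesis
      unfolding hits_def mem_Collect_eq 1 atLeastLessThan_iff 2[symmetric] 3[symmetric] using 4 by blast
  qed
  then have "hits m = {nat \<lceil>g (real m)\<rceil>..<nat \<lceil>g (real m + 1)\<rceil>}" by blast
  moreover have "\<lceil>g (real m)\<rceil> \<le> \<lceil>g (real m + 1)\<rceil>" using lt by (intro ceiling_mono) auto
  moreover have "0 \<le> \<lceil>g (real m)\<rceil>" using Alt by linarith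
  ultimately show ?thesis by simp linarith
qed

lemma sum_floor_f:
  fixes \<phi> :: "nat \<Rightarrow> complex"
  shows "(\<Sum>n\<in>{A<..2*A}. \<phi> (nat \<lfloor>f (real n)\<rfloor>)) =
     (\<Sum>m\<in>{m::nat. X < real m \<and> real m \<le> Y}. \<phi> m * complex_of_real (real (card (hits m))))"
proof -
  have "(\<Sum>n\<in>{A<..2*A}. \<phi> (nat \<lfloor>f (real n)\<rfloor>)) =
     (\<Sum>m\<in>{m::nat. X < real m \<and> real m \<le> Y}.
        \<Sum>n\<in>{n. n \<in> {A<..2*A} \<and> nat \<lfloor>f (real n)\<rfloor> = m}. \<phi> (nat \<lfloor>f (real n)\<rfloor>))"
    using floor_f_in_range by (intro sum.group[symmetric]) auto
  also have "\<dots> = (\<Sum>m\<in>{m::nat. X < real m \<and> real m \<le> Y}. \<phi> m * complex_of_real (real (card (hits m))))"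
    by (intro sum.cong refl) (simp add: hits_def mult.commute)
  finally show ?thesis .
qed

definition discrepancy :: "(nat \<Rightarrow> complex) \<Rightarrow> real" where
  "discrepancy \<phi> = cmod ((\<Sum>n\<in>{A<..2*A}. \<phi> (nat \<lfloor>f (real n)\<rfloor>))
     - (\<Sum>m\<in>{m::nat. X < real m \<and> real m \<le> Y}. \<phi> m * complex_of_real (deriv g (real m))))"

lemma range_properties:
  assumes "u \<in> {X..Y}"
  shows "f (g u) = u" "real A \<le> g u" "g u \<le> 2 * real A" "0 < g u" "deriv g u = 1 / f' (g u)"
    "f' (real A) \<le> f' (g u)" "f' (g u) \<le> growth * f' (real A)"
proof -
  note r = g_range[OF A_pos(1), of "real (2 * A)" u]
  show 1: "f (g u) = u" "real A \<le> g u" "g u \<le> 2 * real A" using r assms by auto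
  then show 2: "0 < g u" using A_pos by linarith
  show "deriv g u = 1 / f' (g u)" using deriv_g[OF 2] 1 by simp
  show "f' (real A) \<le> f' (g u)" using 1 A_pos by (intro f'_mono) auto
  show "f' (g u) \<le> growth * f' (real A)" using 1 A_pos by (intro f'_le_growth) auto
qed

lemma XY_bounds: "real A * f' (real A) \<le> Y - X" "Y - X \<le> growth * real A * f' (real A)" "X < Y" "0 < X"
proof -
  show "real A * f' (real A) \<le> Y - X" using f_diff_ge[of "real A" "real (2 * A)"] A_pos by simp
  have "Y - X \<le> real A * f' (real (2 * A))" using f_diff_le[of "real A" "real (2 * A)"] A_pos by simp
  also have "\<dots> \<le> real A * (growth * f' (real A))"
    using A_pos by (intro mult_left_mono f'_le_growth) auto
  finally show "Y - X \<le> growth * real A * f' (real A)" by (simp add: mult_ac)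
  show "X < Y" using A_pos by (intro f_strict_mono) auto
  show "0 < X" using A_pos by (intro f_pos)
qed

text \<open>The first sum has \<open>A\<close> terms. The second has about
  \<open>growth * A * f' A\<close> terms, each of weight at most \<open>1 / f' A\<close>; the
  possible extra integer is absorbed by \<open>A * f' A \<ge> 1\<close>.\<close>

lemma trivial_bound:
  assumes \<phi>: "\<And>m. X < real m \<Longrightarrow> real m \<le> Y \<Longrightarrow> cmod (\<phi> m) \<le> M" and M: "0 \<le> M"
  shows "discrepancy \<phi> \<le> real A * ((growth + 2) * M)"
proof -
  have F1: "1 \<le> f' (real A)" using f'_ge_1[OF A] .
  have "cmod (\<Sum>n\<in>{A<..2*A}. \<phi> (nat \<lfloor>f (real n)\<rfloor>)) \<le> (\<Sum>n\<in>{A<..2*A}. M)"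
    using floor_f_in_range by (intro sum_norm_le \<phi>) auto
  then have 1: "cmod (\<Sum>n\<in>{A<..2*A}. \<phi> (nat \<lfloor>f (real n)\<rfloor>)) \<le> real A * M" by simp
  have "cmod (\<Sum>m\<in>{m::nat. X < real m \<and> real m \<le> Y}. \<phi> m * complex_of_real (deriv g (real m)))
      \<le> (\<Sum>m\<in>{m::nat. X < real m \<and> real m \<le> Y}. M * (1 / f' (real A)))"
  proof (rule sum_norm_le)
    fix m assume m: "m \<in> {m::nat. X < real m \<and> real m \<le> Y}"
    then have "real m \<in> {X..Y}" by auto
    note r = range_properties[OF this]
    have "\<bar>deriv g (real m)\<bar> \<le> 1 / f' (real A)"
      using r(5,6) f'_pos[OF r(4)] F1 by (auto intro!: divide_left_mono)
    then show "cmod (\<phi> m * complex_of_real (deriv g (real m))) \<le> M * (1 / f' (real A))"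
      unfolding norm_mult norm_of_real using \<phi>[of m] m M by (intro mult_mono) auto
  qed
  also have "\<dots> = real (card {m::nat. X < real m \<and> real m \<le> Y}) * (M / f' (real A))" by simp
  also have "\<dots> \<le> (Y - X + 1) * (M / f' (real A))"
    using XY_bounds M F1 by (intro mult_right_mono card_integer_block_le) auto
  also have "\<dots> \<le> (growth * real A * f' (real A) + real A * f' (real A)) * (M / f' (real A))"
  proof (intro mult_right_mono add_mono XY_bounds)
    show "1 \<le> real A * f' (real A)" using mult_mono[of 1 "real A" 1 "f' (real A)"] A_pos F1 by simp
  qed (use M F1 in auto)
  also have "\<dots> = real A * ((growth + 1) * M)" using F1 by (simp add: field_simps)
  finally show ?thesis
    unfolding discrepancy_def using 1 norm_triangle_ineq4[of "\<Sum>n\<in>{A<..2*A}. \<phi> (nat \<lfloor>f (real n)\<rfloor>)"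
      "\<Sum>m\<in>{m::nat. X < real m \<and> real m \<le> Y}. \<phi> m * complex_of_real (deriv g (real m))"]
    by (simp add: algebra_simps)
qed

text \<open>\<open>\<kappa>1\<close> and \<open>\<kappa>2\<close> enclose
  \<open>- g'' = f'' / f'^3\<close> on the range: doubling bounds \<open>f''\<close> on both sides,
  \<open>growth\<close> bounds \<open>f'\<close> above, and monotonicity bounds it below.\<close>

lemma discrepancy_le_core:
  fixes \<phi> :: "nat \<Rightarrow> complex" and z M :: real and N N1 :: nat
  assumes z: "2 \<le> z" and XY: "X + z + 2 \<le> Y"
    and \<phi>: "\<And>m. X < real m \<Longrightarrow> real m \<le> Y \<Longrightarrow> cmod (\<phi> m) \<le> M" and M: "0 \<le> M"
    and N: "N > 0" and N1: "N1 > 0"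
  defines "F1 \<equiv> f' (real A)" and "F2 \<equiv> f'' (real A)"
  defines "\<kappa>1 \<equiv> F2 / (2 * growth^3 * F1^3)" and "\<kappa>2 \<equiv> c2 * F2 / F1^3"
  assumes \<delta>: "6 * (\<kappa>2 * (z + 1)\<^sup>2) * real N1 \<le> 1"
  defines "\<alpha> \<equiv> (Y - X) * \<kappa>2 / \<kappa>1" and "\<beta> \<equiv> 2 / \<kappa>1"
  defines "V \<equiv> \<lambda>k. ((Y - X) * (z + 1) + 2 * (\<Sum>h=1..<k. (\<alpha> + \<beta> / real h) * (2 * ln (2 * z + 3)))) / real k"
  shows "discrepancy \<phi>
     \<le> 4 * z * M + M * ((z + 1) * \<kappa>2 * (Y - X))
       + 4 * (\<Sum>h=1..<N. min (1 / F1) (1 / real h) * (\<alpha> + \<beta> / real h)) * J f \<phi> A z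
       + M / z * (8 * V N1 + 24 * ((\<Sum>k=1..N. V k) / real N))"
proof -
  have F1: "1 \<le> F1" using f'_ge_1[OF A] by (simp add: F1_def)
  have F2: "0 < F2" using f''_pos A_pos by (simp add: F2_def)
  define p where "p = (\<lambda>u. 1 / f' (g u))"
  define q where "q = (\<lambda>u. f'' (g u) / (f' (g u))^3)"
  \<comment> \<open>The floor extends the count to real arguments, as the type in
    \<open>core_estimate\<close> asks; only values at integers matter.\<close>
  define \<nu> where "\<nu> = (\<lambda>u::real. real (card (hits (nat \<lfloor>u\<rfloor>))))"
  have p_bd: "0 \<le> p u" "p u \<le> 1 / F1" "p u \<le> 1" if "u \<in> {X..Y}" for u
  proof -
    note r = range_properties[OF that]
    have pos: "0 < f' (g u)" "F1 \<le> f' (g u)" using f'_pos[OF r(4)] r(6) by (auto simp: F1_def)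
    then show "0 \<le> p u" "p u \<le> 1 / F1" "p u \<le> 1" using F1 by (auto simp: p_def field_simps)
  qed
  have "discrepancy \<phi> = cmod (\<Sum>m\<in>{m::nat. X < real m \<and> real m \<le> Y}. \<phi> m * complex_of_real (\<nu> (real m) - p (real m)))"
  proof -
    have "deriv g (real m) = p (real m)" if "X < real m" "real m \<le> Y" for m
      using range_properties(5)[of "real m"] that by (simp add: p_def)
    then show ?thesis
      unfolding discrepancy_def sum_floor_f sum_subtractf[symmetric]
      by (intro arg_cong[where f=cmod] sum.cong refl) (simp add: \<nu>_def algebra_simps)
  qed
  also have "\<dots> \<le> 4 * z * M + M * ((z + 1) * \<kappa>2 * (Y - X))
       + 4 * (\<Sum>h=1..<N. min (1 / F1) (1 / real h) * (\<alpha> + \<beta> / real h)) * integral {0..1} (block_sup \<phi> X Y z)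
       + M / z * (8 * V N1 + 24 * ((\<Sum>k=1..N. V k) / real N))"
    unfolding \<alpha>_def \<beta>_def V_def
  proof (rule core_estimate[where g=g and q=q, OF _ z XY _ _ _ _ _ p_bd(1) p_bd(2) \<phi> M _ _ N N1 \<delta>])
    fix u assume u: "u \<in> {X..Y}"
    note r = range_properties[OF u]
    show "(g has_real_derivative p u) (at u)"
      using g_deriv[OF r(4)] r(1) by (simp add: p_def)
    show "(p has_real_derivative - q u) (at u)"
      using g_second_deriv[OF r(4)] r(1) by (simp add: p_def q_def)
    have f2: "F2 \<le> 2 * f'' (g u)" "f'' (g u) \<le> c2 * F2"
      using f''_lower[of "real A" "g u"] f''_upper[of "real A" "g u"] r A_pos by (auto simp: F2_def)
    have pos: "0 < f' (g u)" using f'_pos[OF r(4)] .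
    have "\<kappa>1 = (F2 / 2) / (growth * F1)^3" by (simp add: \<kappa>1_def power_mult_distrib)
    also have "\<dots> \<le> q u"
      unfolding q_def using f2 r(7) pos F2
      by (intro frac_le power_mono) (auto simp: F1_def)
    finally show "\<kappa>1 \<le> q u" .
    show "q u \<le> \<kappa>2"
      unfolding q_def \<kappa>2_def using f2 r(6) F1 F2 c2_ge_1
      by (intro frac_le power_mono) (auto simp: F1_def)
  next
    show "0 < \<kappa>1" using F1 F2 growth_ge_1 by (simp add: \<kappa>1_def)
    show "0 \<le> X" using XY_bounds by simp
  next
    fix m :: nat assume "X < real m" "real m + 1 \<le> Y"
    then show "\<nu> (real m) = of_int \<lceil>g (real m + 1)\<rceil> - of_int \<lceil>g (real m)\<rceil>"
      using card_hits by (simp add: \<nu>_def)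
  next
    fix m :: nat assume m: "X < real m" "real m \<le> Y"
    have "0 \<le> \<nu> (real m)" "\<nu> (real m) \<le> 1" using card_hits_le_1[of m] by (auto simp: \<nu>_def)
    moreover have "0 \<le> p (real m)" "p (real m) \<le> 1" using p_bd[of "real m"] m by auto
    ultimately show "\<bar>\<nu> (real m) - p (real m)\<bar> \<le> 1" by linarith
  qed
  finally show ?thesis by (simp only: J_conv_block_sup)
qed

end

section \<open>Constants, the main range and the remaining cases\<close>

definition log_const :: real where "log_const = 4 + log_growth + 1/2 + \<bar>ln f''_low\<bar>"

text \<open>This and \<open>sum_const\<close> are the coefficients of \<open>P\<close> and
  \<open>Q\<close> in \<open>core_bound_numeric\<close> with \<open>K = growth\<close>,
  \<open>C1 = deriv_ratio\<close> and \<open>C2 = log_const\<close>.\<close>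

definition curvature_const :: real where
  "curvature_const = 4 * deriv_ratio + 2 * c2 * growth + 768 * growth * c2"

definition sum_const :: real where
  "sum_const = (let C3 = 4 * c2 * growth^4 + 4 * growth^3 * deriv_ratio in
     16 * C3 * log_const + 8 * (16 * growth + 4 * log_const * C3 * (2 + 3 * log_const))
     + 24 * (8 * growth * log_const + 4 * log_const^3 * C3 + 8 * log_const * C3))"

text \<open>The three numbers in the last factor belong to the three cases settled by the trivial
  bound.\<close>

definition total_const :: real where
  "total_const = curvature_const + sum_const + (growth + 2) * (8 + 24 * c2 + 2 / f''_low)"

lemma log_const_nonneg: "0 \<le> log_const"
  using log_growth_nonneg by (simp add: log_const_def)

lemma const_nonneg: "0 \<le> curvature_const" "0 \<le> sum_const"
  using log_const_nonneg growth_ge_1 c2_ge_1 deriv_ratio_nonneg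
  by (simp_all add: curvature_const_def sum_const_def Let_def)

text \<open>The lower bound on \<open>z\<close> yields \<open>z \<ge> 2\<close> and
  \<open>F1 * L \<le> z\<close>. Smallness of \<open>P\<close> keeps the tangent error within reach
  of the kernels and bounds \<open>ln z\<close>. The upper bound on \<open>z\<close> leaves room for
  a block inside the range.\<close>

lemma discrepancy_main_range:
  fixes A :: nat and z :: real and \<phi> :: "nat \<Rightarrow> complex"
  assumes A: "A0 \<le> real A" and \<phi>: "\<And>m. cmod (\<phi> m) \<le> 1"
  defines "F1 \<equiv> f' (real A)" and "F2 \<equiv> f'' (real A)" and "L \<equiv> ln (real A)"
  defines "P \<equiv> F2 / F1\<^sup>2 * z\<^sup>2"
  assumes z1: "8 * F1 * L^3 < z" and z2: "P < 1 / (24 * c2)" and z3: "2 * z \<le> real A * F1"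
  shows "discrepancy A \<phi> \<le> real A * (curvature_const * P + sum_const * (F1 * L^3 * J f \<phi> A z))"
proof -
  have A2: "2 \<le> real A" using A A0 by simp
  have F1: "1 \<le> F1" using f'_ge_1[OF A] by (simp add: F1_def)
  have F2: "0 < F2" using f''_pos A2 by (simp add: F2_def)
  have L: "2/3 \<le> L" using ln2_ge_two_thirds ln_mono[of 2 "real A"] A2 unfolding L_def by linarith
  have L3: "2 \<le> 8 * L^3"
    using power_mono[OF L, of 3] by (simp add: power3_eq_cube)
  have "2 * F1 \<le> (8 * L^3) * F1" using L3 F1 by (intro mult_right_mono) auto
  then have zF: "2 * F1 < z" using z1 by (simp add: mult_ac)
  then have z: "2 \<le> z" "F1 \<le> z" using F1 by auto
  have FLz: "F1 * L \<le> z"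
  proof -
    have "1 \<le> 8 * L\<^sup>2" using power_mono[OF L, of 2] by (simp add: power2_eq_square)
    then have "F1 * L * 1 \<le> F1 * L * (8 * L\<^sup>2)" using F1 L by (intro mult_left_mono) auto
    also have "\<dots> = 8 * F1 * L^3" by (simp add: power2_eq_square power3_eq_cube)
    finally show ?thesis using z1 by simp
  qed
  note XY = XY_bounds[OF A, folded F1_def]
  have XYz: "f (real A) + z + 2 \<le> f (real (2 * A))" using XY(1) z3 z by linarith
  define \<J> where "\<J> = J f \<phi> A z"
  have zp: "0 < z" using z by simp
  have \<J>0: "0 \<le> \<J>"
    unfolding \<J>_def J_conv_block_sup
    by (intro integral_nonneg integrable_continuous_real continuous_on_block_sup[OF XY(3) zp] block_sup_nonneg[OF XY(3) zp])
  \<comment> \<open>Any valid bound for \<open>\<phi>\<close> would do for the estimate itself; the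
    minimum lets each error term use whichever of 1 and \<open>z * \<J>\<close> suits it.\<close>
  define M where "M = min 1 (z * \<J>)"
  have M: "0 \<le> M" "M \<le> 1" "M \<le> z * \<J>" using \<J>0 zp by (auto simp: M_def)
  have \<phi>M: "cmod (\<phi> m) \<le> M" if "f (real A) < real m" "real m \<le> f (real (2 * A))" for m
    using \<phi>[of m] norm_le_integral_block_sup[OF XY(3) zp that, of \<phi>] by (simp add: M_def \<J>_def J_conv_block_sup)
  define \<kappa>1 where "\<kappa>1 = F2 / (2 * growth^3 * F1^3)"
  define \<kappa>2 where "\<kappa>2 = c2 * F2 / F1^3"
  define \<delta> where "\<delta> = \<kappa>2 * (z + 1)\<^sup>2"
  have \<kappa>2: "0 < \<kappa>2" using F1 F2 c2_ge_1 by (simp add: \<kappa>2_def)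
  \<comment> \<open>\<open>\<delta> * F1 \<le> 4 * c2 * P\<close>, which explains the threshold
    \<open>1 / (24 * c2)\<close>.\<close>
  have \<delta>: "6 * \<delta> * F1 \<le> 1"
  proof -
    have "(z + 1)\<^sup>2 \<le> (2 * z)\<^sup>2" using z by (intro power_mono) auto
    then have "\<delta> * F1 \<le> \<kappa>2 * (2 * z)\<^sup>2 * F1"
      unfolding \<delta>_def using \<kappa>2 F1 by (intro mult_left_mono mult_right_mono) auto
    also have "\<dots> = 4 * c2 * P"
      using F1 by (simp add: \<kappa>2_def P_def field_simps power2_eq_square power3_eq_cube)
    finally show ?thesis using z2 c2_ge_1 by (simp add: field_simps)
  qed
  have \<delta>p: "0 < \<delta>" using \<kappa>2 z by (simp add: \<delta>_def)
  have "6 * \<delta> * 1 \<le> 6 * \<delta> * F1" using F1 \<delta>p by (intro mult_left_mono) auto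
  then have \<delta>1: "6 * \<delta> \<le> 1" using \<delta> by simp
  define N where "N = nat \<lceil>z\<rceil>"
  have N: "z \<le> real N" "real N \<le> 2 * z" "0 < N" unfolding N_def using z by linarith+
  obtain N1 where N1: "0 < N1" "N1 \<le> N" "6 * \<delta> * real N1 \<le> 1" "1 / real N1 \<le> 12 * \<delta> + 1 / real N"
    using exists_kernel_degree[OF \<delta>p \<delta>1 N(3)] by blast
  \<comment> \<open>\<open>P \<le> 1\<close> means \<open>F2 * z^2 \<le> F1^2\<close>. As
    \<open>A * F2\<close> is bounded below and \<open>F1\<close> grows polynomially,
    \<open>z\<close> is at most a power of \<open>A\<close>.\<close>
  have lnz: "ln z \<le> (log_growth + 1/2 + \<bar>ln f''_low\<bar>) * L"
  proof -
    have "1 / (24 * c2) \<le> 1" using c2_ge_1 by simp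
    then have "P \<le> 1" using z2 by simp
    then have "F2 * z\<^sup>2 \<le> F1\<^sup>2" using F1 by (simp add: P_def field_simps)
    have "f''_low * z\<^sup>2 \<le> (real A * F2) * z\<^sup>2"
      using f''_low_le[OF A] by (intro mult_right_mono) (auto simp: F2_def)
    also have "\<dots> \<le> real A * F1\<^sup>2"
      using \<open>F2 * z\<^sup>2 \<le> F1\<^sup>2\<close> A2 by (simp add: mult.assoc)
    finally have "ln (f''_low * z\<^sup>2) \<le> ln (real A * F1\<^sup>2)"
      using f''_low_pos zp by (intro ln_mono) auto
    then have "ln f''_low + 2 * ln z \<le> L + 2 * ln F1"
      using f''_low_pos zp A2 F1 by (simp add: ln_mult ln_realpow L_def)
    moreover have "ln F1 \<le> log_growth * L" using ln_f'_le[OF A] by (simp add: F1_def L_def)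
    moreover have "\<bar>ln f''_low\<bar> * 1 \<le> \<bar>ln f''_low\<bar> * (2 * L)" using L by (intro mult_left_mono) auto
    ultimately show ?thesis by (simp add: algebra_simps)
  qed
  have ln2: "ln 2 \<le> (1::real)" using ln_2_less_1 by simp
  have lnN: "1 + ln (real N) \<le> log_const * L"
  proof -
    have "ln (real N) \<le> ln (2 * z)" using N by (intro ln_mono) auto
    also have "\<dots> = ln 2 + ln z" using zp by (simp add: ln_mult)
    finally show ?thesis using lnz L ln2 by (simp add: log_const_def algebra_simps)
  qed
  have lnz3: "ln (2 * z + 3) \<le> log_const * L"
  proof -
    have "ln (2 * z + 3) \<le> ln (2 * (2 * z))" using z by (intro ln_mono) auto
    also have "\<dots> = ln 2 + (ln 2 + ln z)"
      using zp ln_mult[of 2 "2 * z"] ln_mult[of 2 z] by simp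
    finally show ?thesis using lnz L ln2 by (simp add: log_const_def algebra_simps)
  qed
  note core = discrepancy_le_core[where \<phi>=\<phi>, OF A z(1) XYz _ M(1) N(3) N1(1),
      folded F1_def F2_def, folded \<kappa>1_def \<kappa>2_def, folded \<delta>_def, OF _ N1(3), folded \<J>_def]
  show ?thesis
    unfolding P_def \<J>_def[symmetric] curvature_const_def sum_const_def Let_def
  proof (rule order.trans[OF core core_bound_numeric[OF _ F1 F2 _ z(1) _ growth_ge_1 c2_ge_1
          deriv_ratio_nonneg log_const_nonneg M \<J>0 XY(2) \<kappa>1_def \<kappa>2_def _ z(2) FLz N(1) lnN lnz3
          N1(1,2) N1(4)[unfolded \<delta>_def] \<delta>[unfolded \<delta>_def]]])
    show "F1 \<le> deriv_ratio * real A * F2 * L"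
      using f'_le_f''[OF A] by (simp add: F1_def F2_def L_def)
  qed (use A2 L XY \<phi>M in auto)
qed

text \<open>Outside the main range one of the two terms on the right already dominates the trivial
  bound, taken with \<open>M = z * \<J>\<close> when \<open>z\<close> is small and with
  \<open>M = 1\<close> otherwise.\<close>

lemma discrepancy_bound:
  fixes A :: nat and z :: real and \<phi> :: "nat \<Rightarrow> complex"
  assumes A: "A0 \<le> real A" and \<phi>: "\<And>m. cmod (\<phi> m) \<le> 1" and z: "0 < z"
  shows "1 / real A * discrepancy A \<phi> \<le>
     total_const * (f'' (real A) / (f' (real A))\<^sup>2 * z\<^sup>2 + f' (real A) * (ln (real A))^3 * J f \<phi> A z)"
proof -
  define F1 where "F1 = f' (real A)"
  define F2 where "F2 = f'' (real A)"
  define L where "L = ln (real A)"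
  define P where "P = F2 / F1\<^sup>2 * z\<^sup>2"
  define \<J> where "\<J> = J f \<phi> A z"
  define Q where "Q = F1 * L^3 * \<J>"
  have A2: "2 \<le> real A" using A A0 by simp
  have F1: "1 \<le> F1" using f'_ge_1[OF A] by (simp add: F1_def)
  have F2: "0 < F2" using f''_pos A2 by (simp add: F2_def)
  have L: "0 \<le> L" using A2 by (simp add: L_def)
  note XY = XY_bounds(3)[OF A]
  have \<J>0: "0 \<le> \<J>"
    unfolding \<J>_def J_conv_block_sup
    by (intro integral_nonneg integrable_continuous_real continuous_on_block_sup[OF XY z] block_sup_nonneg[OF XY z])
  have PQ: "0 \<le> P" "0 \<le> Q" using F1 F2 L \<J>0 by (auto simp: P_def Q_def)
  have K: "0 \<le> growth + 2" using growth_ge_1 by simp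
  have triv: "discrepancy A \<phi> \<le> real A * ((growth + 2) * M)" if "M = 1 \<or> M = z * \<J>" for M
  proof (rule trivial_bound[OF A])
    show "cmod (\<phi> m) \<le> M" if "f (real A) < real m" "real m \<le> f (real (2 * A))" for m
      using \<open>M = 1 \<or> M = z * \<J>\<close> \<phi>[of m] norm_le_integral_block_sup[OF XY z that, of \<phi>]
      by (auto simp: \<J>_def J_conv_block_sup)
    show "0 \<le> M" using that \<J>0 z by auto
  qed
  have "\<exists>a b. 0 \<le> a \<and> 0 \<le> b \<and> a \<le> total_const \<and> b \<le> total_const \<and> discrepancy A \<phi> \<le> real A * (a * P + b * Q)"
  proof -
    have tc: "(growth + 2) * 8 \<le> total_const" "(growth + 2) * (24 * c2) \<le> total_const"
      "(growth + 2) * (2 / f''_low) \<le> total_const" "curvature_const \<le> total_const" "sum_const \<le> total_const"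
      and nn: "0 \<le> total_const"
    proof -
      have t: "0 \<le> (growth + 2) * 8" "0 \<le> (growth + 2) * (24 * c2)" "0 \<le> (growth + 2) * (2 / f''_low)"
        using K c2_ge_1 f''_low_pos by (auto intro!: mult_nonneg_nonneg)
      have "total_const = curvature_const + sum_const
          + ((growth + 2) * 8 + (growth + 2) * (24 * c2) + (growth + 2) * (2 / f''_low))"
        unfolding total_const_def distrib_left ..
      then show "(growth + 2) * 8 \<le> total_const" "(growth + 2) * (24 * c2) \<le> total_const"
        "(growth + 2) * (2 / f''_low) \<le> total_const" "curvature_const \<le> total_const" "sum_const \<le> total_const"
        "0 \<le> total_const"
        using t const_nonneg by linarith+
    qed
    consider "z \<le> 8 * F1 * L^3" | "1 / (24 * c2) \<le> P" | "real A * F1 < 2 * z"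
      | "8 * F1 * L^3 < z" "P < 1 / (24 * c2)" "2 * z \<le> real A * F1"
      by linarith
    then show ?thesis
    proof cases
      case 1
      have "z * \<J> \<le> (8 * F1 * L^3) * \<J>" using 1 \<J>0 by (intro mult_right_mono) auto
      then have "real A * ((growth + 2) * (z * \<J>)) \<le> real A * ((growth + 2) * (8 * Q))"
        using K by (intro mult_left_mono) (auto simp: Q_def mult_ac)
      then have "discrepancy A \<phi> \<le> real A * (0 * P + ((growth + 2) * 8) * Q)"
        using triv[of "z * \<J>"] by (simp add: mult_ac)
      then show ?thesis using tc nn K by (intro exI[of _ 0] exI[of _ "(growth + 2) * 8"]) auto
    next
      case 2
      then have "1 \<le> 24 * c2 * P" using c2_ge_1 by (simp add: field_simps)
      then have "real A * ((growth + 2) * 1) \<le> real A * ((growth + 2) * (24 * c2 * P))"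
        using K by (intro mult_left_mono) auto
      then have "discrepancy A \<phi> \<le> real A * (((growth + 2) * (24 * c2)) * P + 0 * Q)"
        using triv[of 1] by (simp add: mult_ac)
      then show ?thesis using tc nn K c2_ge_1
        by (intro exI[of _ "(growth + 2) * (24 * c2)"] exI[of _ 0]) (auto intro!: mult_nonneg_nonneg)
    next
      case 3
      \<comment> \<open>A block as long as half of \<open>A * F1\<close> forces \<open>P\<close> to
        be large: \<open>4 * P \<ge> A * (A * F2)\<close>, and \<open>A * F2\<close> is at least
        \<open>f''_low\<close>.\<close>
      have "(real A * F1)\<^sup>2 \<le> (2 * z)\<^sup>2" using 3 F1 by (intro power_mono) auto
      then have "F2 * (real A * F1)\<^sup>2 \<le> F2 * (2 * z)\<^sup>2" using F2 by (intro mult_left_mono) auto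
      then have "real A * (real A * F2) \<le> 4 * P"
        using F1 by (simp add: P_def field_simps power2_eq_square)
      moreover have "2 * f''_low \<le> real A * (real A * F2)"
        using A2 f''_low_le[OF A] f''_low_pos by (intro mult_mono) (auto simp: F2_def)
      ultimately have "1 \<le> (2 / f''_low) * P" using f''_low_pos by (simp add: field_simps)
      then have "real A * ((growth + 2) * 1) \<le> real A * ((growth + 2) * ((2 / f''_low) * P))"
        using K by (intro mult_left_mono) auto
      then have "discrepancy A \<phi> \<le> real A * (((growth + 2) * (2 / f''_low)) * P + 0 * Q)"
        using triv[of 1] by (simp add: mult_ac)
      then show ?thesis using tc nn K f''_low_pos
        by (intro exI[of _ "(growth + 2) * (2 / f''_low)"] exI[of _ 0]) (auto intro!: mult_nonneg_nonneg)
    next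
      case 4
      have "discrepancy A \<phi> \<le> real A * (curvature_const * P + sum_const * Q)"
        using discrepancy_main_range[OF A \<phi>, of z] 4
        by (simp add: F1_def F2_def L_def P_def Q_def \<J>_def)
      then show ?thesis using tc const_nonneg by blast
    qed
  qed
  then obtain a b where ab: "a \<le> total_const" "b \<le> total_const" "discrepancy A \<phi> \<le> real A * (a * P + b * Q)"
    by blast
  have "1 / real A * discrepancy A \<phi> \<le> a * P + b * Q"
    using ab(3) A2 by (simp add: field_simps)
  also have "\<dots> \<le> total_const * P + total_const * Q"
    using ab PQ by (intro add_mono mult_right_mono) auto
  finally show ?thesis by (simp add: P_def Q_def F1_def F2_def L_def \<J>_def distrib_left)
qed

end

theorem theorem1:
  fixes f f' f'' :: "real \<Rightarrow> real" and c1 c2 A0 :: real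
  assumes f_deriv: "\<And>x. x > 0 \<Longrightarrow> (f has_real_derivative f' x) (at x)"
      and f'_deriv: "\<And>x. x > 0 \<Longrightarrow> (f' has_real_derivative f'' x) (at x)"
      and f''_cont: "continuous_on {0<..} f''"
      and f_pos: "\<And>x. x > 0 \<Longrightarrow> f x > 0"
      and f'_pos: "\<And>x. x > 0 \<Longrightarrow> f' x > 0"
      and f''_pos: "\<And>x. x > 0 \<Longrightarrow> f'' x > 0"
      and c1: "c1 \<ge> 1/2" and c2: "c2 > 0"
      and doubling: "\<And>x y. 0 < x \<Longrightarrow> x \<le> y \<Longrightarrow> y \<le> 2 * x \<Longrightarrow>
                        c1 * f'' x \<le> f'' y \<and> f'' y \<le> c2 * f'' x"
      and A0: "A0 \<ge> 2" "f' A0 \<ge> 1"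
  shows "\<exists>C. \<forall>\<phi> :: nat \<Rightarrow> complex. (\<forall>m. cmod (\<phi> m) \<le> 1) \<longrightarrow>
           (\<forall>(A::nat) (z::real). real A \<ge> A0 \<longrightarrow> z > 0 \<longrightarrow>
              (1 / real A) * cmod ((\<Sum>n\<in>{A<..2*A}. \<phi> (nat \<lfloor>f (real n)\<rfloor>))
                 - (\<Sum>m\<in>{m::nat. f (real A) < real m \<and> real m \<le> f (real (2*A))}.
                      \<phi> m * complex_of_real (deriv (inv_into {0<..} f) (real m))))
              \<le> C * (f'' (real A) / (f' (real A))^2 * z^2
                     + f' (real A) * (ln (real A))^3 * J f \<phi> A z))"
proof -
  interpret doubling_function f f' f'' c2 A0
  proof
    fix x y :: real assume xy: "0 < x" "x \<le> y" "y \<le> 2 * x"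
    have "1/2 * f'' x \<le> c1 * f'' x" using c1 f''_pos[OF xy(1)] by (intro mult_right_mono) auto
    then show "f'' x \<le> 2 * f'' y" using doubling[OF xy] by simp
    show "f'' y \<le> c2 * f'' x" using doubling[OF xy] by simp
  qed (use assms in auto)
  show ?thesis
    using discrepancy_bound by (intro exI[of _ total_const]) (simp add: discrepancy_def)
qed

end
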